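(* Let $G$ be a locally compact second countable topological group and let $m$ be a non-degenerate, spread out and symmetric probability measure on $G$. Let $\mu$ be an $m$-stationary probability measure on $X$ such that the $m$-stationary system $\mathbf{X}=(X,\mathcal{B},\mu,G)$ is $m$-proximal. Then: (1) The nonsingular system $\mathbf{X}$ is doubly ergodic. (2) The product system $\mathbf{X}^2=\mathbf{X}\times\mathbf{X}$ (the diagonal $G$-action on $(X\times X,\mu\times\mu)$) is ergodic with isometric coefficients (EIC).
   Context: A probability measure $m$ on $G$ is spread out if some convolution power $m^{*n}$ is not singular with respect to the Haar measure class; non-degenerate if the minimal closed semigroup $S\subset G$ with $m(S)=1$ is $G$; symmetric if it is invariant under $x\mapsto x^{-1}$. A probability measure $\mu$ on a standard Borel $G$-space $(X,\mathcal{B})$ is $m$-stationary if $m*\mu=\mu$; for non-degenerate and spread out $m$ the measure $\mu$ is then quasi-invariant ($\mu(gA)=0\iff\mu(A)=0$), so $\mathbf{X}=(X,\mathcal{B},\mu,G)$ is a nonsingular $G$-system. One can always choose a topological model for $\mathbf{X}$, i.e. take $X$ to be a compact metric space on which $G$ acts by homeomorphisms. Let $\Omega=G^{\mathbb{N}}$, $P=m^{\mathbb{N}}$ and let $\xi_n:\Omega\to G$ be the $n$-th coordinate projection. For $X$ compact metric, the weak-* limits $\mu_\omega=\lim_{n\to\infty}\xi_1(\omega)\xi_2(\omega)\cdots\xi_n(\omega)\mu$ exist for $P$-a.e. $\omega\in\Omega$. The system $\mathbf{X}$ is $m$-proximal if $\mu_\omega$ is a point mass for $P$-a.e. $\omega$;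 this property does not depend on the chosen topological model. A nonsingular system is ergodic if every measurable $B$ with $gB=B$ modulo null sets for all $g$ is null or co-null. It is doubly ergodic if the diagonal action on its cartesian square (with the product measure) is ergodic. It is EIC if there is no non-constant Borel measurable equivariant map from it to a separable metric space $(Z,d)$ on which $G$ acts by isometries (equivariant: for each $g$, $\phi(gx)=g\phi(x)$ for a.e. $x$; non-constant: not a.e. equal to a constant). *)

theory Defs
  imports "HOL-Probability.Probability"
begin

text \<open>
  The group \<open>G\<close> is a type of class \<open>topological_group_add\<close>, which is the library's class of
  (not necessarily commutative) topological groups. It is written additively, so
  \<open>g + h\<close>, \<open>0\<close>, \<open>- g\<close> stand for the product \<open>gh\<close>, the unit and the inverse of \<open>g\<close>.
  A measure space \<open>(X, \<B>, \<mu>)\<close> is a single term \<open>\<mu> :: 'x measure\<close>, with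
  \<open>X = space \<mu>\<close> and \<open>\<B> = sets \<mu>\<close>; an action is a function \<open>'g \<Rightarrow> 'x \<Rightarrow> 'x\<close>, of which only the
  values on \<open>space \<mu>\<close> matter.
\<close>

definition borel_of :: "'a topology \<Rightarrow> 'a measure" where
  "borel_of T = sigma (topspace T) {U. openin T U}"

definition standard_borel :: "'x measure \<Rightarrow> bool" where
  "standard_borel M \<longleftrightarrow>
     (\<exists>T. completely_metrizable_space T \<and> second_countable T \<and>
          space M = topspace T \<and> sets M = sets (borel_of T))"

definition action_on :: "('g::group_add \<Rightarrow> 'x \<Rightarrow> 'x) \<Rightarrow> 'x set \<Rightarrow> bool" where
  "action_on act X \<longleftrightarrow>
     (\<forall>g. \<forall>x\<in>X. act g x \<in> X) \<and>
     (\<forall>x\<in>X. act 0 x = x) \<and>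
     (\<forall>g h. \<forall>x\<in>X. act (g + h) x = act g (act h x))"

definition standard_borel_G_space ::
    "('g::topological_group_add \<Rightarrow> 'x \<Rightarrow> 'x) \<Rightarrow> 'x measure \<Rightarrow> bool" where
  "standard_borel_G_space act M \<longleftrightarrow>
     standard_borel M \<and> action_on act (space M) \<and>
     (\<lambda>(g, x). act g x) \<in> measurable (borel \<Otimes>\<^sub>M M) M"

definition convolve :: "('g \<Rightarrow> 'x \<Rightarrow> 'x) \<Rightarrow> 'g measure \<Rightarrow> 'x measure \<Rightarrow> 'x measure" where
  "convolve act m \<mu> = distr (m \<Otimes>\<^sub>M \<mu>) \<mu> (\<lambda>(g, x). act g x)"

primrec conv_power :: "'g::topological_group_add measure \<Rightarrow> nat \<Rightarrow> 'g measure" where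
  "conv_power m 0 = return borel 0"
| "conv_power m (Suc n) = convolve (+) m (conv_power m n)"

text \<open>On a locally compact second countable Hausdorff group, every Borel measure that is finite
  on compact sets is a Radon measure, so no regularity condition is needed.\<close>

definition haar_measure :: "'g::topological_group_add measure \<Rightarrow> bool" where
  "haar_measure \<eta> \<longleftrightarrow>
     sets \<eta> = sets borel \<and> emeasure \<eta> UNIV \<noteq> 0 \<and>
     (\<forall>K. compact K \<longrightarrow> emeasure \<eta> K < \<infinity>) \<and>
     (\<forall>g. distr \<eta> borel (\<lambda>h. g + h) = \<eta>)"

definition mutually_singular :: "'a measure \<Rightarrow> 'a measure \<Rightarrow> bool" where
  "mutually_singular M N \<longleftrightarrow>
     (\<exists>A \<in> sets M \<inter> sets N. emeasure M A = 0 \<and> emeasure N (space N - A) = 0)"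

text \<open>Haar measure is unique up to a scalar, so its choice does not matter below.\<close>

definition spread_out :: "'g::topological_group_add measure \<Rightarrow> bool" where
  "spread_out m \<longleftrightarrow>
     (\<exists>\<eta>. haar_measure \<eta> \<and> (\<exists>n>0. \<not> mutually_singular (conv_power m n) \<eta>))"

definition non_degenerate :: "'g::topological_group_add measure \<Rightarrow> bool" where
  "non_degenerate m \<longleftrightarrow>
     \<Inter>{S. closed S \<and> (\<forall>x\<in>S. \<forall>y\<in>S. x + y \<in> S) \<and> emeasure m S = 1} = UNIV"

definition symmetric_measure :: "'g::topological_group_add measure \<Rightarrow> bool" where
  "symmetric_measure m \<longleftrightarrow> distr m m uminus = m"

definition stationary :: "'g measure \<Rightarrow> ('g \<Rightarrow> 'x \<Rightarrow> 'x) \<Rightarrow> 'x measure \<Rightarrow> bool" where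
  "stationary m act \<mu> \<longleftrightarrow> convolve act m \<mu> = \<mu>"

definition nonsingular_system ::
    "('g::topological_group_add \<Rightarrow> 'x \<Rightarrow> 'x) \<Rightarrow> 'x measure \<Rightarrow> bool" where
  "nonsingular_system act \<mu> \<longleftrightarrow>
     standard_borel_G_space act \<mu> \<and> prob_space \<mu> \<and>
     (\<forall>g. \<forall>A \<in> sets \<mu>. emeasure \<mu> (act g ` A) = 0 \<longleftrightarrow> emeasure \<mu> A = 0)"

definition ergodic_system ::
    "('g::topological_group_add \<Rightarrow> 'x \<Rightarrow> 'x) \<Rightarrow> 'x measure \<Rightarrow> bool" where
  "ergodic_system act \<mu> \<longleftrightarrow>
     nonsingular_system act \<mu> \<and>
     (\<forall>B \<in> sets \<mu>. (\<forall>g. sym_diff (act g ` B) B \<in> null_sets \<mu>) \<longrightarrow>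
        emeasure \<mu> B = 0 \<or> emeasure \<mu> (space \<mu> - B) = 0)"

definition diagonal_action :: "('g \<Rightarrow> 'x \<Rightarrow> 'x) \<Rightarrow> 'g \<Rightarrow> 'x \<times> 'x \<Rightarrow> 'x \<times> 'x" where
  "diagonal_action act g = (\<lambda>(x, y). (act g x, act g y))"

definition doubly_ergodic ::
    "('g::topological_group_add \<Rightarrow> 'x \<Rightarrow> 'x) \<Rightarrow> 'x measure \<Rightarrow> bool" where
  "doubly_ergodic act \<mu> \<longleftrightarrow>
     nonsingular_system act \<mu> \<and> ergodic_system (diagonal_action act) (\<mu> \<Otimes>\<^sub>M \<mu>)"

text \<open>The carriers \<open>Z\<close> range over subsets of a type \<open>'z\<close>, which is a parameter because
  a formula cannot quantify over types; a theorem about \<open>EIC TYPE('z)\<close> with \<open>'z\<close> free covers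
  all separable metric spaces. No continuity in \<open>g\<close> of the action on \<open>Z\<close> is required.\<close>

definition EIC ::
    "'z itself \<Rightarrow> ('g::topological_group_add \<Rightarrow> 'x \<Rightarrow> 'x) \<Rightarrow> 'x measure \<Rightarrow> bool" where
  "EIC _ act \<mu> \<longleftrightarrow>
     nonsingular_system act \<mu> \<and>
     (\<forall>(Z :: 'z set) d z_act \<phi>.
        Metric_space Z d \<and> separable_space (Metric_space.mtopology Z d) \<and>
        action_on z_act Z \<and> (\<forall>g. \<forall>z\<in>Z. \<forall>w\<in>Z. d (z_act g z) (z_act g w) = d z w) \<and>
        \<phi> \<in> measurable \<mu> (borel_of (Metric_space.mtopology Z d)) \<and>
        (\<forall>g. AE x in \<mu>. \<phi> (act g x) = z_act g (\<phi> x))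
        \<longrightarrow> (\<exists>z\<in>Z. AE x in \<mu>. \<phi> x = z))"

text \<open>\<open>(T, \<nu>, b_act)\<close> is a compact metrizable model of the system \<open>(\<mu>, act)\<close>: the two systems are
  isomorphic modulo null sets, via the mutually inverse maps \<open>\<phi>\<close> and \<open>\<psi>\<close>. Joint continuity of the
  model action is not demanded; for a locally compact second countable group it follows
  from joint measurability.\<close>

definition topological_model ::
    "('g::topological_group_add \<Rightarrow> 'x \<Rightarrow> 'x) \<Rightarrow> 'x measure \<Rightarrow>
     'y topology \<Rightarrow> ('g \<Rightarrow> 'y \<Rightarrow> 'y) \<Rightarrow> 'y measure \<Rightarrow> bool" where
  "topological_model act \<mu> T b_act \<nu> \<longleftrightarrow>
     compact_space T \<and> metrizable_space T \<and>
     space \<nu> = topspace T \<and> sets \<nu> = sets (borel_of T) \<and>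
     standard_borel_G_space b_act \<nu> \<and> (\<forall>g. homeomorphic_map T T (b_act g)) \<and>
     (\<exists>\<phi> \<in> measurable \<mu> \<nu>. \<exists>\<psi> \<in> measurable \<nu> \<mu>.
        distr \<mu> \<nu> \<phi> = \<nu> \<and>
        (AE x in \<mu>. \<psi> (\<phi> x) = x) \<and> (AE y in \<nu>. \<phi> (\<psi> y) = y) \<and>
        (\<forall>g. AE x in \<mu>. \<phi> (act g x) = b_act g (\<phi> x)))"

definition weak_star_limit :: "'y topology \<Rightarrow> (nat \<Rightarrow> 'y measure) \<Rightarrow> 'y measure \<Rightarrow> bool" where
  "weak_star_limit T \<nu>s \<nu> \<longleftrightarrow>
     (\<forall>f. continuous_map T euclideanreal f \<longrightarrow>
        (\<lambda>n. \<integral>y. f y \<partial>(\<nu>s n)) \<longlonglongrightarrow> (\<integral>y. f y \<partial>\<nu>))"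

text \<open>Coordinates of \<open>\<Omega>\<close> are indexed from \<open>0\<close>: the walk at time \<open>n\<close> is
  \<open>\<omega> 0 + \<omega> 1 + \<dots> + \<omega> (n - 1)\<close>, in this order.\<close>

definition walk :: "(nat \<Rightarrow> 'g::group_add) \<Rightarrow> nat \<Rightarrow> 'g" where
  "walk \<omega> n = sum_list (map \<omega> [0..<n])"

text \<open>Proximality does not depend on the topological model, and a model always exists. As in
  \<open>EIC\<close>, the type \<open>'y\<close> is a parameter; a theorem assuming \<open>m_proximal TYPE('y)\<close> with \<open>'y\<close> free
  applies to models on any type.\<close>

definition m_proximal ::
    "'y itself \<Rightarrow> 'g::topological_group_add measure \<Rightarrow>
     ('g \<Rightarrow> 'x \<Rightarrow> 'x) \<Rightarrow> 'x measure \<Rightarrow> bool" where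
  "m_proximal _ m act \<mu> \<longleftrightarrow>
     (\<exists>(T :: 'y topology) b_act \<nu>. topological_model act \<mu> T b_act \<nu> \<and>
        (AE \<omega> in (\<Pi>\<^sub>M i\<in>(UNIV :: nat set). m).
           \<exists>y\<in>topspace T.
             weak_star_limit T (\<lambda>n. distr \<nu> \<nu> (b_act (walk \<omega> n))) (return \<nu> y)))"

end

theory Submission
  imports Defs
begin

text \<open>
  Write \<open>p A g = \<mu> {x. g x \<in> A}\<close>. Since the random walk pushes \<open>\<mu>\<close> to point masses in the
  weak-* sense and the average of the pushed measures is \<open>\<mu>\<close> itself, approximating \<open>A\<close> by
  continuous functions in \<open>L\<^sup>1\<close> gives \<open>\<integral> p A (1 - p A) d m\<^sup>*\<^sup>n \<longlonglongrightarrow> 0\<close> for every measurable \<open>A\<close>. Let \<open>\<phi>\<close> be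
  an equivariant map from the square to an isometric space. The probability that \<open>\<phi> (x, y)\<close> and
  \<open>\<phi> (x, y')\<close> are at distance at least \<open>r\<close> does not change when \<open>x\<close> is replaced by \<open>g x\<close> with
  \<open>g\<close> distributed as \<open>m\<^sup>*\<^sup>n\<close>; by isometry and symmetry of \<open>m\<close> this amounts to replacing \<open>y\<close> and
  \<open>y'\<close> by \<open>g y\<close> and \<open>g y'\<close>. Cutting the target into pieces of diameter less than \<open>r\<close> bounds the
  result by a sum of the above integrals, so \<open>\<phi>\<close> depends on neither coordinate. Ergodicity of the
  square is the case of the two-point space with the trivial action.

  Quasi-invariance of \<open>\<mu>\<close> holds because \<open>g \<mapsto> \<mu> (g\<^sup>-\<^sup>1 A)\<close> is a bounded harmonic function that
  vanishes at the unit if \<open>A\<close> is null: for spread out \<open>m\<close> such a function vanishes identically.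
\<close>

section \<open>Borel sets of a topology and regularity of finite measures\<close>

lemma space_borel_of [simp]: "space (borel_of T) = topspace T"
  by (simp add: borel_of_def space_measure_of_conv)

lemma sets_borel_of: "sets (borel_of T) = sigma_sets (topspace T) {U. openin T U}"
  unfolding borel_of_def by (rule sets_measure_of) (auto dest: openin_subset)

lemma borel_of_openin: "openin T U \<Longrightarrow> U \<in> sets (borel_of T)"
  by (simp add: sets_borel_of)

lemma borel_of_closedin:
  assumes "closedin T C" shows "C \<in> sets (borel_of T)"
proof -
  have "topspace T - C \<in> sets (borel_of T)"
    using assms by (intro borel_of_openin) (simp add: closedin_def)
  then have "space (borel_of T) - (topspace T - C) \<in> sets (borel_of T)"
    by (rule sets.compl_sets)
  moreover have "space (borel_of T) - (topspace T - C) = C"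
    using closedin_subset[OF assms] by auto
  ultimately show ?thesis by simp
qed

lemma sets_borel_of_euclidean: "sets (borel_of euclidean) = sets borel"
  by (simp add: sets_borel_of borel_def sets_measure_of)

lemma continuous_map_borel_measurable:
  fixes f :: "'a \<Rightarrow> real"
  assumes "continuous_map T euclideanreal f" "sets M = sets (borel_of T)"
  shows "f \<in> borel_measurable M"
proof -
  have sp: "space M = topspace T" using sets_eq_imp_space_eq[OF assms(2)] by simp
  show ?thesis
  proof (rule borel_measurableI)
    fix S :: "real set" assume "open S"
    then have "openin T {x \<in> topspace T. f x \<in> S}"
      using assms(1) by (auto simp: continuous_map_def)
    then show "f -` S \<inter> space M \<in> sets M"
      using assms(2) borel_of_openin[of T "{x \<in> topspace T. f x \<in> S}"]
      by (simp add: sp vimage_def Int_def conj_commute)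
  qed
qed

text \<open>The sets with such approximations form a sigma-algebra: complements swap the roles of
  \<open>C\<close> and \<open>U\<close>, countable unions use geometrically decreasing errors. Open
  sets belong to it because \<open>fsig\<close> exhausts them by closed sets. This form of the
  hypothesis serves both a metrizable model space and the locally compact second countable
  group.\<close>

lemma (in finite_measure) regular_closed_open:
  assumes sets: "sets M = sets (borel_of T)"
    and fsig: "\<And>U. openin T U \<Longrightarrow> fsigma_in T U"
    and A: "A \<in> sets M" and e: "0 < e"
  shows "\<exists>C U. closedin T C \<and> openin T U \<and> C \<subseteq> A \<and> A \<subseteq> U \<and> measure M (U - C) < e"
proof -
  have sp: "space M = topspace T" using sets_eq_imp_space_eq[OF sets] by simp
  have cl: "C \<in> sets M" if "closedin T C" for C using borel_of_closedin[OF that] sets by simp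
  have op: "C \<in> sets M" if "openin T C" for C using borel_of_openin[OF that] sets by simp
  have "A \<in> sigma_sets (topspace T) {U. openin T U}" using A sets by (simp add: sets_borel_of)
  then show ?thesis using e
  proof (induction arbitrary: e)
    case (Basic U)
    then obtain C where C: "\<And>n. closedin T (C n)" "\<And>n. C n \<subseteq> C (Suc n)" "\<Union>(range C) = U"
      using fsig[of U] by (auto simp: fsigma_in_ascending)
    have "(\<lambda>n. measure M (U - C n)) \<longlonglongrightarrow> measure M (\<Inter>n. U - C n)"
      using C(1,2) Basic(1) by (intro finite_Lim_measure_decseq) (auto intro!: cl op decseq_SucI)
    moreover have empty: "(\<Inter>n. U - C n) = {}" using C(3) by auto
    ultimately have "(\<lambda>n. measure M (U - C n)) \<longlonglongrightarrow> 0" unfolding empty by simp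
    then have "eventually (\<lambda>n. measure M (U - C n) < e) sequentially"
      using Basic(2) by (rule order_tendstoD)
    then obtain n where "measure M (U - C n) < e" by (auto simp: eventually_sequentially)
    then show ?case using C Basic by (intro exI[of _ "C n"] exI[of _ U]) auto
  next
    case Empty
    then show ?case by (intro exI[of _ "{}"]) auto
  next
    case (Compl A)
    then obtain C U where CU: "closedin T C" "openin T U" "C \<subseteq> A" "A \<subseteq> U" "measure M (U - C) < e"
      by meson
    have "(topspace T - C) - (topspace T - U) = U - C"
      using openin_subset[OF CU(2)] by auto
    with CU show ?case
      by (intro exI[of _ "topspace T - U"] exI[of _ "topspace T - C"]) (auto simp: closedin_def)
  next
    case (Union A)
    \<comment> \<open>These errors sum to \<open>e / 2\<close>; the strict gap below
      \<open>e\<close> is spent on truncating the union of the \<open>C i\<close>.\<close>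
    have pos: "0 < e * (1/2) ^ (i + 2)" for i :: nat using Union.prems by simp
    have "\<forall>i. \<exists>C U. closedin T C \<and> openin T U \<and> C \<subseteq> A i \<and> A i \<subseteq> U \<and>
        measure M (U - C) < e * (1/2) ^ (i + 2)"
      using Union.IH[OF pos] by blast
    then obtain C U where CU: "\<And>i. closedin T (C i)" "\<And>i. openin T (U i)" "\<And>i. C i \<subseteq> A i"
      "\<And>i. A i \<subseteq> U i" "\<And>i. measure M (U i - C i) < e * (1/2) ^ (i + 2)"
      by metis
    have [measurable]: "C i \<in> sets M" "U i \<in> sets M" for i using CU by (auto intro: cl op)
    have s: "(\<lambda>i. e * (1/2) ^ (i + 2)) sums (e/2)"
      using sums_mult[OF power_half_series, of "e/2"] by (simp add: field_simps)
    have sm: "summable (\<lambda>i. measure M (U i - C i))"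
      by (rule summable_comparison_test[OF _ sums_summable[OF s]])
         (use CU(5) in \<open>auto intro!: exI[of _ 0] less_imp_le\<close>)
    have "measure M ((\<Union>i. U i) - (\<Union>i. C i)) \<le> measure M (\<Union>i. U i - C i)"
      by (rule finite_measure_mono) auto
    also have "\<dots> \<le> (\<Sum>i. measure M (U i - C i))"
      using sm by (intro finite_measure_subadditive_countably) auto
    also have "\<dots> \<le> e / 2"
      using suminf_le[OF _ sm sums_summable[OF s]] CU(5) sums_unique[OF s] by (metis less_imp_le)
    finally have lt: "measure M ((\<Union>i. U i) - (\<Union>i. C i)) < e" using Union.prems by simp
    \<comment> \<open>The union of all \<open>C i\<close> need not be closed. Its finite partial
      unions are, and by continuity from above one of them keeps the error below
      \<open>e\<close>.\<close>
    have "(\<lambda>n. measure M ((\<Union>i. U i) - (\<Union>i\<le>n. C i))) \<longlonglongrightarrow> measure M (\<Inter>n. (\<Union>i. U i) - (\<Union>i\<le>n. C i))"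
      by (intro finite_Lim_measure_decseq) (auto simp: decseq_def)
    moreover have "(\<Inter>n. (\<Union>i. U i) - (\<Union>i\<le>n. C i)) = (\<Union>i. U i) - (\<Union>i. C i)"
      by auto
    ultimately have "eventually (\<lambda>n. measure M ((\<Union>i. U i) - (\<Union>i\<le>n. C i)) < e) sequentially"
      using lt by (intro order_tendstoD) auto
    then obtain n where "measure M ((\<Union>i. U i) - (\<Union>i\<le>n. C i)) < e"
      by (auto simp: eventually_sequentially)
    moreover have "closedin T (\<Union>i\<le>n. C i)" using CU(1) by (intro closedin_Union) auto
    moreover have "openin T (\<Union>i. U i)" using CU(2) by auto
    ultimately show ?case using CU(3,4)
      by (intro exI[of _ "\<Union>i\<le>n. C i"] exI[of _ "\<Union>i. U i"]) (auto, blast+)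
  qed
qed

section \<open>Products of second countable and of standard Borel spaces\<close>

lemma second_countable_prod_topology:
  assumes "second_countable S" "second_countable T"
  shows "second_countable (prod_topology S T)"
proof -
  obtain A where A: "countable A" "\<forall>V\<in>A. openin S V" "\<And>U x. openin S U \<Longrightarrow> x \<in> U \<Longrightarrow> \<exists>V\<in>A. x \<in> V \<and> V \<subseteq> U"
    using assms(1) unfolding second_countable_def by metis
  obtain B where B: "countable B" "\<forall>V\<in>B. openin T V" "\<And>U x. openin T U \<Longrightarrow> x \<in> U \<Longrightarrow> \<exists>V\<in>B. x \<in> V \<and> V \<subseteq> U"
    using assms(2) unfolding second_countable_def by metis
  show ?thesis unfolding second_countable_def
  proof (intro exI[of _ "(\<lambda>(V, W). V \<times> W) ` (A \<times> B)"] conjI ballI allI impI)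
    show "countable ((\<lambda>(V, W). V \<times> W) ` (A \<times> B))" using A B by auto
    show "openin (prod_topology S T) V" if "V \<in> (\<lambda>(V, W). V \<times> W) ` (A \<times> B)" for V
      using that A B by (auto simp: openin_prod_Times_iff)
    fix U and x :: "'a \<times> 'b" assume U: "openin (prod_topology S T) U \<and> x \<in> U"
    obtain y z where x: "x = (y, z)" by (cases x)
    from U obtain V W where "openin S V" "openin T W" "y \<in> V" "z \<in> W" "V \<times> W \<subseteq> U"
      unfolding openin_prod_topology_alt x by metis
    then show "\<exists>V\<in>(\<lambda>(V, W). V \<times> W) ` (A \<times> B). x \<in> V \<and> V \<subseteq> U"
      using A(3)[of V y] B(3)[of W z] x by (simp, meson Sigma_mono order_trans mem_Sigma_iff)
  qed
qed

text \<open>One inclusion is continuity of the projections. The other uses countable bases: an open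
  set of the product is a countable union of rectangles with basic sides.\<close>

lemma sets_pair_borel_of:
  assumes "second_countable S" "second_countable T"
  shows "sets (borel_of S \<Otimes>\<^sub>M borel_of T) = sets (borel_of (prod_topology S T))"
proof (rule antisym)
  show "sets (borel_of S \<Otimes>\<^sub>M borel_of T) \<subseteq> sets (borel_of (prod_topology S T))"
  proof -
    have "fst \<in> measurable (borel_of (prod_topology S T)) (borel_of S)"
      unfolding borel_of_def[of S]
      by (rule measurable_measure_of)
         (auto intro!: borel_of_openin dest: openin_subset
           openin_continuous_map_preimage[OF continuous_map_fst[of S T]]
           simp: vimage_def Int_def conj_commute)
    moreover have "snd \<in> measurable (borel_of (prod_topology S T)) (borel_of T)"
      unfolding borel_of_def[of T]
      by (rule measurable_measure_of)
         (auto intro!: borel_of_openin dest: openin_subset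
           openin_continuous_map_preimage[OF continuous_map_snd[of S T]]
           simp: vimage_def Int_def conj_commute)
    ultimately have "(\<lambda>x. (fst x, snd x)) \<in> measurable (borel_of (prod_topology S T)) (borel_of S \<Otimes>\<^sub>M borel_of T)"
      by (intro measurable_Pair)
    then have *: "id \<in> measurable (borel_of (prod_topology S T)) (borel_of S \<Otimes>\<^sub>M borel_of T)"
      by (simp add: id_def)
    show ?thesis
    proof
      fix A assume A: "A \<in> sets (borel_of S \<Otimes>\<^sub>M borel_of T)"
      have "A \<subseteq> topspace S \<times> topspace T" using sets.sets_into_space[OF A] by (simp add: space_pair_measure)
      then show "A \<in> sets (borel_of (prod_topology S T))"
        using measurable_sets[OF * A] by (simp add: Int_absorb2)
    qed
  qed
  obtain A where A: "countable A" "\<forall>V\<in>A. openin S V" "\<And>U x. openin S U \<Longrightarrow> x \<in> U \<Longrightarrow> \<exists>V\<in>A. x \<in> V \<and> V \<subseteq> U"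
    using assms(1) unfolding second_countable_def by metis
  obtain B where B: "countable B" "\<forall>V\<in>B. openin T V" "\<And>U x. openin T U \<Longrightarrow> x \<in> U \<Longrightarrow> \<exists>V\<in>B. x \<in> V \<and> V \<subseteq> U"
    using assms(2) unfolding second_countable_def by metis
  show "sets (borel_of (prod_topology S T)) \<subseteq> sets (borel_of S \<Otimes>\<^sub>M borel_of T)"
  proof -
    have "U \<in> sets (borel_of S \<Otimes>\<^sub>M borel_of T)" if U: "openin (prod_topology S T) U" for U
    proof -
      have eq: "U = (\<Union>(V, W)\<in>{(V, W)\<in>A \<times> B. V \<times> W \<subseteq> U}. V \<times> W)"
      proof (intro equalityI subsetI)
        fix x assume xU: "x \<in> U"
        obtain y z where x: "x = (y, z)" by (cases x)
        from U xU obtain V W where "openin S V" "openin T W" "y \<in> V" "z \<in> W" "V \<times> W \<subseteq> U"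
          unfolding openin_prod_topology_alt x by metis
        then show "x \<in> (\<Union>(V, W)\<in>{(V, W)\<in>A \<times> B. V \<times> W \<subseteq> U}. V \<times> W)"
          using A(3)[of V y] B(3)[of W z] x by (simp, meson Sigma_mono order_trans mem_Sigma_iff)
      qed auto
      have "(\<Union>(V, W)\<in>{(V, W)\<in>A \<times> B. V \<times> W \<subseteq> U}. V \<times> W) \<in> sets (borel_of S \<Otimes>\<^sub>M borel_of T)"
        using A B by (intro sets.countable_UN'') (auto intro!: countable_subset[OF _ countable_SIGMA[of A "\<lambda>_. B"]] pair_measureI borel_of_openin)
      then show ?thesis using eq by simp
    qed
    moreover have "topspace (prod_topology S T) = space (borel_of S \<Otimes>\<^sub>M borel_of T)"
      by (simp add: space_pair_measure)
    ultimately show ?thesis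
      unfolding sets_borel_of[of "prod_topology S T"]
      by (metis (no_types, lifting) mem_Collect_eq sets.sigma_sets_subset subsetI)
  qed
qed

text \<open>Needed for the square, since \<open>nonsingular_system\<close> asks its space to be
  standard Borel.\<close>

lemma standard_borel_pair_measure:
  assumes "standard_borel M" "standard_borel N"
  shows "standard_borel (M \<Otimes>\<^sub>M N)"
proof -
  obtain S where S: "completely_metrizable_space S" "second_countable S" "space M = topspace S" "sets M = sets (borel_of S)"
    using assms(1) unfolding standard_borel_def by metis
  obtain T where T: "completely_metrizable_space T" "second_countable T" "space N = topspace T" "sets N = sets (borel_of T)"
    using assms(2) unfolding standard_borel_def by metis
  show ?thesis unfolding standard_borel_def
    using S T sets_pair_borel_of[OF S(2) T(2)] sets_pair_measure_cong[OF S(4) T(4)]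
    by (intro exI[of _ "prod_topology S T"])
       (auto simp: completely_metrizable_space_prod_topology second_countable_prod_topology space_pair_measure)
qed

section \<open>Random walks and stationary actions\<close>

text \<open>Second countability makes the Borel sets of the product group equal to the product
  sigma-algebra, so that addition is measurable there.\<close>

locale random_walk = prob_space m
  for m :: "'g::{topological_group_add, second_countable_topology} measure" +
  assumes sets_m [measurable_cong]: "sets m = sets borel"
begin

lemma space_m [simp]: "space m = UNIV"
  using sets_eq_imp_space_eq[OF sets_m] by simp

lemma borel_measurable_uminus_group [measurable]: "(uminus :: 'g \<Rightarrow> 'g) \<in> borel_measurable borel"
  by (intro borel_measurable_continuous_onI continuous_intros)

lemma sets_conv_power [measurable_cong, simp]: "sets (conv_power m n) = sets borel"
  by (induction n) (auto simp: convolve_def)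

lemma space_conv_power [simp]: "space (conv_power m n) = UNIV"
  using sets_eq_imp_space_eq[OF sets_conv_power] by simp

lemma prob_space_conv_power: "prob_space (conv_power m n)"
proof (induction n)
  case 0
  then show ?case by (simp add: prob_space_return)
next
  case (Suc n)
  interpret P: prob_space "conv_power m n" by fact
  interpret Q: pair_prob_space m "conv_power m n" ..
  show ?case unfolding conv_power.simps convolve_def
    by (rule Q.prob_space_distr) measurable
qed

lemma nn_integral_conv_power_Suc:
  assumes [measurable]: "f \<in> borel_measurable borel"
  shows "(\<integral>\<^sup>+g. f g \<partial>conv_power m (Suc n)) = (\<integral>\<^sup>+a. \<integral>\<^sup>+b. f (a + b) \<partial>conv_power m n \<partial>m)"
proof -
  interpret P: prob_space "conv_power m n" by (rule prob_space_conv_power)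
  have "(\<integral>\<^sup>+g. f g \<partial>conv_power m (Suc n)) = (\<integral>\<^sup>+x. f (fst x + snd x) \<partial>(m \<Otimes>\<^sub>M conv_power m n))"
    unfolding conv_power.simps convolve_def by (subst nn_integral_distr) (auto simp: split_beta')
  also have "\<dots> = (\<integral>\<^sup>+a. \<integral>\<^sup>+b. f (a + b) \<partial>conv_power m n \<partial>m)"
    by (subst P.nn_integral_fst[symmetric]) auto
  finally show ?thesis .
qed

text \<open>The recursion of \<open>conv_power\<close> splits off the leftmost factor. Associativity
  and Fubini allow the rightmost one to be split off instead, which is the form needed after an
  inversion has reversed the order.\<close>

lemma nn_integral_conv_power_Suc':
  assumes [measurable]: "f \<in> borel_measurable borel"
  shows "(\<integral>\<^sup>+g. f g \<partial>conv_power m (Suc n)) = (\<integral>\<^sup>+a. \<integral>\<^sup>+b. f (b + a) \<partial>conv_power m n \<partial>m)"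
  using assms
proof (induction n arbitrary: f)
  case 0
  then have [measurable]: "f \<in> borel_measurable borel" .
  then show ?case using nn_integral_conv_power_Suc[OF 0, of 0]
    by (simp add: nn_integral_return del: conv_power.simps(2))
next
  case (Suc n)
  note [measurable] = Suc.prems
  interpret P: prob_space "conv_power m n" by (rule prob_space_conv_power)
  interpret P': prob_space "conv_power m (Suc n)" by (rule prob_space_conv_power)
  interpret PP: pair_sigma_finite m m ..
  have "(\<integral>\<^sup>+g. f g \<partial>conv_power m (Suc (Suc n))) = (\<integral>\<^sup>+a. \<integral>\<^sup>+g. f (a + g) \<partial>conv_power m (Suc n) \<partial>m)"
    by (rule nn_integral_conv_power_Suc) fact
  also have "\<dots> = (\<integral>\<^sup>+a. \<integral>\<^sup>+c. \<integral>\<^sup>+b. f (a + (b + c)) \<partial>conv_power m n \<partial>m \<partial>m)"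
    by (intro nn_integral_cong, rule Suc.IH) measurable
  also have "\<dots> = (\<integral>\<^sup>+c. \<integral>\<^sup>+a. \<integral>\<^sup>+b. f (a + b + c) \<partial>conv_power m n \<partial>m \<partial>m)"
    by (subst PP.Fubini') (auto simp: add.assoc)
  also have "\<dots> = (\<integral>\<^sup>+c. \<integral>\<^sup>+g. f (g + c) \<partial>conv_power m (Suc n) \<partial>m)"
    by (intro nn_integral_cong, rule nn_integral_conv_power_Suc[symmetric]) measurable
  finally show ?case .
qed

text \<open>Inversion turns the leftmost factor into the rightmost one. The induction hypothesis
  inverts the remaining \<open>n\<close> factors, symmetry of \<open>m\<close> the last one, and the
  right-hand recursion reassembles them.\<close>

lemma nn_integral_conv_power_uminus:
  assumes sym: "symmetric_measure m" and f: "f \<in> borel_measurable borel"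
  shows "(\<integral>\<^sup>+g. f (- g) \<partial>conv_power m n) = (\<integral>\<^sup>+g. f g \<partial>conv_power m n)"
  using f
proof (induction n arbitrary: f)
  case 0
  then show ?case by (simp add: nn_integral_return)
next
  case (Suc n)
  note [measurable] = Suc.prems
  interpret P: prob_space "conv_power m n" by (rule prob_space_conv_power)
  have "(\<integral>\<^sup>+g. f (- g) \<partial>conv_power m (Suc n)) = (\<integral>\<^sup>+a. \<integral>\<^sup>+b. f (- (a + b)) \<partial>conv_power m n \<partial>m)"
    by (rule nn_integral_conv_power_Suc) measurable
  also have "\<dots> = (\<integral>\<^sup>+a. \<integral>\<^sup>+b. f (- b + - a) \<partial>conv_power m n \<partial>m)"
    by (simp add: minus_add)
  also have "\<dots> = (\<integral>\<^sup>+a. \<integral>\<^sup>+b. f (b + - a) \<partial>conv_power m n \<partial>m)"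
  proof (rule nn_integral_cong)
    fix a
    show "(\<integral>\<^sup>+b. f (- b + - a) \<partial>conv_power m n) = (\<integral>\<^sup>+b. f (b + - a) \<partial>conv_power m n)"
      by (rule Suc.IH[of "\<lambda>b. f (b + - a)"]) measurable
  qed
  also have "\<dots> = (\<integral>\<^sup>+a. \<integral>\<^sup>+b. f (b + a) \<partial>conv_power m n \<partial>distr m m uminus)"
    by (subst nn_integral_distr) auto
  also have "\<dots> = (\<integral>\<^sup>+g. f g \<partial>conv_power m (Suc n))"
    using sym unfolding symmetric_measure_def
    by (subst nn_integral_conv_power_Suc') auto
  finally show ?case .
qed

lemma measurable_walk [measurable]: "(\<lambda>\<omega>. walk \<omega> n) \<in> borel_measurable (\<Pi>\<^sub>M i\<in>(UNIV :: nat set). m)"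
proof (induction n)
  case 0
  then show ?case by (simp add: walk_def)
next
  case (Suc n)
  note [measurable] = Suc
  have "(\<lambda>\<omega>. \<omega> n) \<in> measurable (\<Pi>\<^sub>M i\<in>(UNIV :: nat set). m) m"
    by (rule measurable_component_singleton) simp
  then have [measurable]: "(\<lambda>\<omega>. \<omega> n) \<in> borel_measurable (\<Pi>\<^sub>M i\<in>(UNIV :: nat set). m)"
    by (simp cong: measurable_cong_sets add: sets_m)
  have "(\<lambda>\<omega>. walk \<omega> n + \<omega> n) \<in> borel_measurable (\<Pi>\<^sub>M i\<in>(UNIV :: nat set). m)"
    by measurable
  then show ?case by (simp add: walk_def)
qed

lemma walk_case_nat: "walk (case_nat a \<omega>) (Suc n) = a + walk \<omega> n"
proof -
  have "map (case_nat a \<omega>) [0..<Suc n] = a # map \<omega> [0..<n]"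
    by (simp add: upt_conv_Cons map_Suc_upt[symmetric] comp_def del: upt_Suc)
  then show ?thesis by (simp add: walk_def del: upt_Suc)
qed

text \<open>The path measure is the image of \<open>m\<close> times itself under prepending a
  coordinate (\<open>S.PiM_iter\<close>). Splitting off the first step matches the left-hand
  recursion of \<open>conv_power\<close>.\<close>

lemma nn_integral_walk:
  assumes f: "f \<in> borel_measurable borel"
  shows "(\<integral>\<^sup>+\<omega>. f (walk \<omega> n) \<partial>(\<Pi>\<^sub>M i\<in>(UNIV :: nat set). m)) = (\<integral>\<^sup>+g. f g \<partial>conv_power m n)"
proof -
  interpret S: sequence_space m by unfold_locales
  show ?thesis using f
  proof (induction n arbitrary: f)
    case 0
    then show ?case by (simp add: walk_def nn_integral_return S.P.emeasure_space_1)
  next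
    case (Suc n)
    note [measurable] = Suc.prems
    have "(\<integral>\<^sup>+\<omega>. f (walk \<omega> (Suc n)) \<partial>S.S) =
        (\<integral>\<^sup>+\<omega>. f (walk \<omega> (Suc n)) \<partial>distr (m \<Otimes>\<^sub>M S.S) S.S (\<lambda>(s, \<omega>). case_nat s \<omega>))"
      by (simp only: S.PiM_iter)
    also have "\<dots> = (\<integral>\<^sup>+x. f (fst x + walk (snd x) n) \<partial>(m \<Otimes>\<^sub>M S.S))"
      by (subst nn_integral_distr) (auto simp: split_beta' walk_case_nat)
    also have "\<dots> = (\<integral>\<^sup>+a. \<integral>\<^sup>+\<omega>. f (a + walk \<omega> n) \<partial>S.S \<partial>m)"
      by (subst S.P.nn_integral_fst[symmetric]) auto
    also have "\<dots> = (\<integral>\<^sup>+a. \<integral>\<^sup>+b. f (a + b) \<partial>conv_power m n \<partial>m)"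
      by (intro nn_integral_cong, rule Suc.IH) measurable
    also have "\<dots> = (\<integral>\<^sup>+g. f g \<partial>conv_power m (Suc n))"
      by (rule nn_integral_conv_power_Suc[symmetric]) measurable
    finally show ?case .
  qed
qed

lemma distr_walk: "distr (\<Pi>\<^sub>M i\<in>(UNIV :: nat set). m) borel (\<lambda>\<omega>. walk \<omega> n) = conv_power m n"
proof (rule measure_eqI)
  fix A assume "A \<in> sets (distr (\<Pi>\<^sub>M i\<in>(UNIV :: nat set). m) borel (\<lambda>\<omega>. walk \<omega> n))"
  then have A[measurable]: "A \<in> sets borel" by simp
  have "emeasure (distr (\<Pi>\<^sub>M i\<in>(UNIV :: nat set). m) borel (\<lambda>\<omega>. walk \<omega> n)) A =
     (\<integral>\<^sup>+\<omega>. indicator A (walk \<omega> n) \<partial>(\<Pi>\<^sub>M i\<in>(UNIV :: nat set). m))"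
    by (subst nn_integral_distr[symmetric, where f="indicator A" and M'=borel]) auto
  also have "\<dots> = emeasure (conv_power m n) A"
    by (subst nn_integral_walk) auto
  finally show "emeasure (distr (\<Pi>\<^sub>M i\<in>(UNIV :: nat set). m) borel (\<lambda>\<omega>. walk \<omega> n)) A = emeasure (conv_power m n) A" .
qed simp

end

section \<open>Measurable and stationary actions\<close>

locale measurable_action =
  fixes act :: "'g::{topological_group_add, second_countable_topology} \<Rightarrow> 'x \<Rightarrow> 'x"
    and \<mu> :: "'x measure"
  assumes standard: "standard_borel_G_space act \<mu>"
begin

lemma measurable_act [measurable]: "(\<lambda>(g, x). act g x) \<in> measurable (borel \<Otimes>\<^sub>M \<mu>) \<mu>"
  using standard by (simp add: standard_borel_G_space_def)

lemma measurable_act_pair [measurable]: "(\<lambda>p. act (fst p) (snd p)) \<in> measurable (borel \<Otimes>\<^sub>M \<mu>) \<mu>"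
  using measurable_act by (simp add: split_beta')

lemma measurable_act_single [measurable]: "act g \<in> measurable \<mu> \<mu>"
  using measurable_Pair2[OF measurable_act, of g] by simp

lemma act_space [simp]: "x \<in> space \<mu> \<Longrightarrow> act g x \<in> space \<mu>"
  and act_0 [simp]: "x \<in> space \<mu> \<Longrightarrow> act 0 x = x"
  and act_add: "x \<in> space \<mu> \<Longrightarrow> act (g + h) x = act g (act h x)"
  using standard by (auto simp: standard_borel_G_space_def action_on_def)

lemma act_minus_left [simp]: "x \<in> space \<mu> \<Longrightarrow> act (- g) (act g x) = x"
  and act_minus_right [simp]: "x \<in> space \<mu> \<Longrightarrow> act g (act (- g) x) = x"
  using act_add[of x "- g" g] act_add[of x g "- g"] by auto

text \<open>Quasi-invariance and ergodicity are phrased with images; as preimages under the inverse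
  element they become accessible to measurability arguments.\<close>

lemma image_act: "A \<subseteq> space \<mu> \<Longrightarrow> act g ` A = {x \<in> space \<mu>. act (- g) x \<in> A}"
  by (force simp: subset_iff intro: image_eqI[of _ _ "act (- g) _"])

lemma image_act_sets: "A \<in> sets \<mu> \<Longrightarrow> act g ` A \<in> sets \<mu>"
  using sets.sets_into_space by (subst image_act) auto

end

text \<open>One implication for all \<open>g\<close> suffices: an image under \<open>g\<close> is a
  preimage under \<open>- g\<close>, and \<open>A\<close> is the preimage under \<open>g\<close> of
  its own image.\<close>

lemma (in measurable_action) nonsingular_systemI:
  assumes prob: "prob_space \<mu>"
    and null: "\<And>A g. A \<in> sets \<mu> \<Longrightarrow> emeasure \<mu> A = 0 \<Longrightarrow> emeasure \<mu> {x\<in>space \<mu>. act g x \<in> A} = 0"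
  shows "nonsingular_system act \<mu>"
  unfolding nonsingular_system_def
proof (intro conjI allI ballI)
  fix g A assume A: "A \<in> sets \<mu>"
  have eq: "act g ` A = {x\<in>space \<mu>. act (- g) x \<in> A}"
    using sets.sets_into_space[OF A] by (rule image_act)
  have "{x\<in>space \<mu>. act g x \<in> act g ` A} = A"
    using sets.sets_into_space[OF A] by (auto simp: eq)
  then have "emeasure \<mu> A = 0" if "emeasure \<mu> (act g ` A) = 0"
    using null[OF image_act_sets[OF A] that, of g] by simp
  moreover have "emeasure \<mu> (act g ` A) = 0" if "emeasure \<mu> A = 0"
    using null[OF A that, of "- g"] unfolding eq .
  ultimately show "emeasure \<mu> (act g ` A) = 0 \<longleftrightarrow> emeasure \<mu> A = 0" by blast
qed (rule standard, rule prob)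

lemma (in measurable_action) standard_borel_G_space_diagonal:
  "standard_borel_G_space (diagonal_action act) (\<mu> \<Otimes>\<^sub>M \<mu>)"
  unfolding standard_borel_G_space_def
proof (intro conjI)
  show "standard_borel (\<mu> \<Otimes>\<^sub>M \<mu>)"
    using standard by (intro standard_borel_pair_measure) (simp_all add: standard_borel_G_space_def)
  show "action_on (diagonal_action act) (space (\<mu> \<Otimes>\<^sub>M \<mu>))"
    by (auto simp: action_on_def diagonal_action_def space_pair_measure act_add)
  have "(\<lambda>p. (act (fst p) (fst (snd p)), act (fst p) (snd (snd p)))) \<in> measurable (borel \<Otimes>\<^sub>M (\<mu> \<Otimes>\<^sub>M \<mu>)) (\<mu> \<Otimes>\<^sub>M \<mu>)"
    by measurable
  then show "(\<lambda>(g, x). diagonal_action act g x) \<in> measurable (borel \<Otimes>\<^sub>M (\<mu> \<Otimes>\<^sub>M \<mu>)) (\<mu> \<Otimes>\<^sub>M \<mu>)"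
    by (simp add: diagonal_action_def split_beta')
qed

locale stationary_action = random_walk m + measurable_action act \<mu> + \<mu>: prob_space \<mu>
  for m :: "'g::{topological_group_add, second_countable_topology} measure" and act \<mu> +
  assumes stat: "stationary m act \<mu>"
begin

lemma nn_integral_stationary_1:
  assumes [measurable]: "f \<in> borel_measurable \<mu>"
  shows "(\<integral>\<^sup>+g. \<integral>\<^sup>+x. f (act g x) \<partial>\<mu> \<partial>m) = (\<integral>\<^sup>+x. f x \<partial>\<mu>)"
proof -
  have "(\<integral>\<^sup>+x. f x \<partial>\<mu>) = (\<integral>\<^sup>+x. f x \<partial>distr (m \<Otimes>\<^sub>M \<mu>) \<mu> (\<lambda>(g, x). act g x))"
    using stat by (simp add: stationary_def convolve_def)
  also have "\<dots> = (\<integral>\<^sup>+p. f (act (fst p) (snd p)) \<partial>(m \<Otimes>\<^sub>M \<mu>))"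
    by (subst nn_integral_distr) (auto simp: split_beta')
  also have "\<dots> = (\<integral>\<^sup>+g. \<integral>\<^sup>+x. f (act g x) \<partial>\<mu> \<partial>m)"
    by (subst \<mu>.nn_integral_fst[symmetric]) auto
  finally show ?thesis by simp
qed

text \<open>With \<open>act (a + b) x = act a (act b x)\<close>, the inner integral over
  \<open>b\<close> is the induction hypothesis for the function \<open>f\<close> composed with
  \<open>act a\<close>.\<close>

lemma nn_integral_stationary:
  assumes f: "f \<in> borel_measurable \<mu>"
  shows "(\<integral>\<^sup>+g. \<integral>\<^sup>+x. f (act g x) \<partial>\<mu> \<partial>conv_power m n) = (\<integral>\<^sup>+x. f x \<partial>\<mu>)"
  using f
proof (induction n arbitrary: f)
  case 0
  note [measurable] = 0
  have "(\<integral>\<^sup>+g. \<integral>\<^sup>+x. f (act g x) \<partial>\<mu> \<partial>conv_power m 0) = (\<integral>\<^sup>+x. f (act 0 x) \<partial>\<mu>)"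
    by (simp add: nn_integral_return)
  also have "\<dots> = (\<integral>\<^sup>+x. f x \<partial>\<mu>)" by (intro nn_integral_cong) simp
  finally show ?case .
next
  case (Suc n)
  note [measurable] = Suc.prems
  have "(\<integral>\<^sup>+g. \<integral>\<^sup>+x. f (act g x) \<partial>\<mu> \<partial>conv_power m (Suc n)) =
      (\<integral>\<^sup>+a. \<integral>\<^sup>+b. \<integral>\<^sup>+x. f (act (a + b) x) \<partial>\<mu> \<partial>conv_power m n \<partial>m)"
    by (rule nn_integral_conv_power_Suc) measurable
  also have "\<dots> = (\<integral>\<^sup>+a. \<integral>\<^sup>+b. \<integral>\<^sup>+x. f (act a (act b x)) \<partial>\<mu> \<partial>conv_power m n \<partial>m)"
    by (intro nn_integral_cong) (simp add: act_add)
  also have "\<dots> = (\<integral>\<^sup>+a. \<integral>\<^sup>+x. f (act a x) \<partial>\<mu> \<partial>m)"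
    by (intro nn_integral_cong, rule Suc.IH) measurable
  also have "\<dots> = (\<integral>\<^sup>+x. f x \<partial>\<mu>)"
    by (rule nn_integral_stationary_1) fact
  finally show ?case .
qed

end

section \<open>Haar measure and spread out random walks\<close>

text \<open>A locally compact Hausdorff space is regular, so compact neighbourhoods exist inside
  every open set.\<close>

lemma locally_compact_open_compact_nhds:
  fixes U :: "'a::t2_space set"
  assumes lc: "locally_compact_space (euclidean :: 'a topology)" and "open U" "x \<in> U"
  shows "\<exists>V K. open V \<and> compact K \<and> x \<in> V \<and> V \<subseteq> K \<and> K \<subseteq> U"
proof -
  have H: "Hausdorff_space (euclidean :: 'a topology)"
    unfolding Hausdorff_space_def disjnt_def
  proof (intro allI impI)
    fix x y :: 'a assume "x \<in> topspace euclidean \<and> y \<in> topspace euclidean \<and> x \<noteq> y"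
    then obtain U V where "open U" "open V" "x \<in> U" "y \<in> V" "U \<inter> V = {}"
      using hausdorff[of x y] by blast
    then show "\<exists>U V. openin euclidean U \<and> openin euclidean V \<and> x \<in> U \<and> y \<in> V \<and> U \<inter> V = {}"
      by (intro exI[of _ U] exI[of _ V]) simp
  qed
  have "neighbourhood_base_of (compactin euclidean) (euclidean :: 'a topology)"
    using lc locally_compact_Hausdorff_imp_regular_space[OF lc H]
    by (rule locally_compact_imp_neighbourhood_base)
  with assms(2,3) show ?thesis unfolding neighbourhood_base_of by simp
qed

lemma locally_compact_compact_open_nhds:
  fixes U :: "'a::t2_space set"
  assumes lc: "locally_compact_space (euclidean :: 'a topology)" and "open U" "compact K" "K \<subseteq> U"
  shows "\<exists>V L. open V \<and> compact L \<and> K \<subseteq> V \<and> V \<subseteq> L \<and> L \<subseteq> U"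
proof -
  have "\<forall>x\<in>K. \<exists>V L. open V \<and> compact L \<and> x \<in> V \<and> V \<subseteq> L \<and> L \<subseteq> U"
    using locally_compact_open_compact_nhds[OF lc assms(2)] assms(4) by blast
  from bchoice[OF this] obtain V where
    "\<forall>x\<in>K. \<exists>L. open (V x) \<and> compact L \<and> x \<in> V x \<and> V x \<subseteq> L \<and> L \<subseteq> U" ..
  from bchoice[OF this] obtain L where
    VL: "\<forall>x\<in>K. open (V x) \<and> compact (L x) \<and> x \<in> V x \<and> V x \<subseteq> L x \<and> L x \<subseteq> U" ..
  obtain F where F: "F \<subseteq> K" "finite F" "K \<subseteq> (\<Union>x\<in>F. V x)"
    using compactE_image[OF assms(3), of K V] VL by blast
  have "open (\<Union>x\<in>F. V x)" "compact (\<Union>x\<in>F. L x)"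
    using VL F(1,2) by (auto intro!: compact_UN)
  moreover have "(\<Union>x\<in>F. V x) \<subseteq> (\<Union>x\<in>F. L x)" "(\<Union>x\<in>F. L x) \<subseteq> U"
    using VL F(1) by (fastforce, fastforce)
  ultimately show ?thesis using F(3)
    by (intro exI[of _ "\<Union>x\<in>F. V x"] exI[of _ "\<Union>x\<in>F. L x"]) simp
qed

text \<open>The compact closures of basic sets that lie within \<open>U\<close> already cover
  \<open>U\<close>, and there are countably many of them.\<close>

lemma locally_compact_second_countable_open_eq_Union_compact:
  fixes U :: "'a::{second_countable_topology, t2_space} set"
  assumes lc: "locally_compact_space (euclidean :: 'a topology)" and U: "open U"
  shows "\<exists>K :: nat \<Rightarrow> 'a set. (\<forall>n. compact (K n)) \<and> (\<Union>n. K n) = U"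
proof -
  obtain B :: "'a set set" where B: "countable B" "topological_basis B"
    using ex_countable_basis by blast
  \<comment> \<open>The empty set is inserted so that the family can be enumerated by
    \<open>nat\<close> even when \<open>U\<close> is empty.\<close>
  define \<K> where "\<K> = insert {} (closure ` {V\<in>B. compact (closure V) \<and> closure V \<subseteq> U})"
  have "countable \<K>" "\<K> \<noteq> {}" using B(1) by (auto simp: \<K>_def)
  then have K: "range (from_nat_into \<K>) = \<K>" by (intro range_from_nat_into)
  have "\<exists>W\<in>\<K>. x \<in> W" if "x \<in> U" for x
  proof -
    obtain V L where VL: "open V" "compact L" "x \<in> V" "V \<subseteq> L" "L \<subseteq> U"
      using locally_compact_open_compact_nhds[OF lc U \<open>x \<in> U\<close>] by blast
    then obtain W where W: "W \<in> B" "x \<in> W" "W \<subseteq> V" using topological_basisE[OF B(2)] by metis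
    have cl: "closure W \<subseteq> L"
      using W VL by (intro closure_minimal compact_imp_closed) auto
    then have "compact (closure W)"
      using compact_Int_closed[OF VL(2) closed_closure[of W]] by (simp add: Int_absorb1)
    then have "closure W \<in> \<K>" using W cl VL unfolding \<K>_def by blast
    then show ?thesis using W closure_subset by blast
  qed
  then have "\<Union>\<K> = U" by (auto simp: \<K>_def)
  moreover have "\<forall>W\<in>\<K>. compact W" by (auto simp: \<K>_def)
  ultimately show ?thesis using K \<open>\<K> \<noteq> {}\<close> from_nat_into by (intro exI[of _ "from_nat_into \<K>"]) auto
qed

text \<open>One point is chosen from each basic open set that meets \<open>Z\<close>. It serves to
  replace uncountably many almost sure conditions, one per point of \<open>Z\<close>, by countably
  many.\<close>

lemma countable_dense_subset:
  fixes Z :: "'a::second_countable_topology set"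
  shows "\<exists>D. countable D \<and> D \<subseteq> Z \<and> Z \<subseteq> closure D"
proof -
  obtain B :: "'a set set" where B: "countable B" "topological_basis B"
    using ex_countable_basis by blast
  define D where "D = (\<lambda>b. SOME z. z \<in> b \<inter> Z) ` {b\<in>B. b \<inter> Z \<noteq> {}}"
  have some: "(SOME z. z \<in> b \<inter> Z) \<in> b \<inter> Z" if "b \<inter> Z \<noteq> {}" for b
    using that by (intro someI_ex[of "\<lambda>z. z \<in> b \<inter> Z"]) blast
  have "countable D" using B(1) by (auto simp: D_def)
  moreover have "D \<subseteq> Z" using some by (auto simp: D_def)
  moreover have "z \<in> closure D" if "z \<in> Z" for z
  proof (subst closure_iff_nhds_not_empty, intro allI impI)
    fix A U assume "U \<subseteq> A" "open U" "z \<in> U"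
    then obtain b where "b \<in> B" "z \<in> b" "b \<subseteq> U" using topological_basisE[OF B(2)] by metis
    then have "b \<inter> Z \<noteq> {}" using that by auto
    then have "(SOME z. z \<in> b \<inter> Z) \<in> D" "(SOME z. z \<in> b \<inter> Z) \<in> A"
      using some[of b] \<open>b \<in> B\<close> \<open>b \<subseteq> U\<close> \<open>U \<subseteq> A\<close> by (auto simp: D_def)
    then show "D \<inter> A \<noteq> {}" by blast
  qed
  ultimately show ?thesis by blast
qed

text \<open>Hahn decompositions of \<open>\<eta>\<close> against \<open>k\<close> times
  \<open>N\<close> on each \<open>K j\<close> give sets \<open>Y j k\<close> with the desired
  inequality. If all of them were \<open>\<eta>\<close>-null, then off their union \<open>B\<close>
  every multiple of \<open>N\<close> would stay below the finite number \<open>\<eta> (K j)\<close>,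
  so \<open>N\<close> would vanish there and \<open>B\<close> would separate the two
  measures.\<close>

lemma not_mutually_singular_imp_le:
  fixes N \<eta> :: "'a measure"
  assumes N: "finite_measure N" and sets: "sets \<eta> = sets N"
    and K: "\<And>j :: nat. K j \<in> sets N" "(\<Union>j. K j) = space N" "\<And>j. emeasure \<eta> (K j) < \<infinity>"
    and nsing: "\<not> mutually_singular N \<eta>"
  shows "\<exists>j k F. F \<in> sets N \<and> F \<subseteq> K j \<and> emeasure \<eta> F > 0 \<and>
    (\<forall>E\<in>sets N. E \<subseteq> F \<longrightarrow> emeasure \<eta> E \<le> of_nat k * emeasure N E)"
proof (rule ccontr)
  assume contr: "\<not> ?thesis"
  interpret N: finite_measure N by fact
  have spc: "space \<eta> = space N" using sets by (rule sets_eq_imp_space_eq)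
  have "\<exists>Y\<in>sets N. Y \<subseteq> K j \<and> (\<forall>X\<in>sets N. X \<subseteq> Y \<longrightarrow> emeasure \<eta> X \<le> of_nat k * emeasure N X)
      \<and> (\<forall>X\<in>sets N. X \<subseteq> K j \<longrightarrow> X \<inter> Y = {} \<longrightarrow> of_nat k * emeasure N X \<le> emeasure \<eta> X)" for j k :: nat
    using unsigned_Hahn_decomposition[of \<eta> "scale_measure (of_nat k) N" "K j"] K(1,3)[of j] sets
    by (auto simp: ennreal_mult_eq_top_iff less_top)
  then obtain Y where Y: "\<And>j k. Y j k \<in> sets N" "\<And>j k. Y j k \<subseteq> K j"
      "\<And>j k X. X \<in> sets N \<Longrightarrow> X \<subseteq> Y j k \<Longrightarrow> emeasure \<eta> X \<le> of_nat k * emeasure N X"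
      "\<And>j k X. X \<in> sets N \<Longrightarrow> X \<subseteq> K j \<Longrightarrow> X \<inter> Y j k = {} \<Longrightarrow> of_nat k * emeasure N X \<le> emeasure \<eta> X"
    by metis
  have Y0: "emeasure \<eta> (Y j k) = 0" for j k
    using contr Y by (metis not_gr_zero)
  define B where "B = (\<Union>j k. Y j k)"
  have [measurable]: "B \<in> sets N" using Y(1) by (auto simp: B_def)
  have B0: "emeasure \<eta> B = 0"
    unfolding B_def using Y0 Y(1) sets
    by (auto intro!: null_setsD1 null_sets_UN simp: null_sets_def)
  have "emeasure N (K j - B) = 0" for j
  proof (rule ccontr)
    assume nz: "emeasure N (K j - B) \<noteq> 0"
    have le: "of_nat k * emeasure N (K j - B) \<le> emeasure \<eta> (K j)" for k
    proof -
      have "of_nat k * emeasure N (K j - B) \<le> emeasure \<eta> (K j - B)"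
        using sets.Diff[OF K(1)[of j] \<open>B \<in> sets N\<close>] by (intro Y(4)) (auto simp: B_def)
      also have "\<dots> \<le> emeasure \<eta> (K j)" using K(1)[of j] sets by (intro emeasure_mono) auto
      finally show ?thesis .
    qed
    have r: "real k * measure N (K j - B) \<le> measure \<eta> (K j)" for k
    proof -
      have "of_nat k * emeasure N (K j - B) = ennreal (real k * measure N (K j - B))"
        by (simp add: N.emeasure_eq_measure ennreal_of_nat_eq_real_of_nat ennreal_mult')
      moreover have "emeasure \<eta> (K j) = ennreal (measure \<eta> (K j))"
        using K(3)[of j] by (intro emeasure_eq_ennreal_measure) simp
      ultimately show ?thesis using le[of k] by simp
    qed
    have "measure N (K j - B) > 0" using nz by (simp add: N.emeasure_eq_measure zero_less_measure_iff)
    then obtain k :: nat where "measure \<eta> (K j) < real k * measure N (K j - B)"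
      using reals_Archimedean3 by blast
    with r[of k] show False by simp
  qed
  then have "emeasure N (\<Union>j. K j - B) = 0"
    using K(1) by (intro null_setsD1 null_sets_UN) (auto simp: null_sets_def)
  moreover have "(\<Union>j. K j - B) = space N - B" using K(2) by auto
  moreover have "space N - (space N - B) = B" using sets.sets_into_space[of B N] by auto
  ultimately have "mutually_singular N \<eta>"
    using B0 sets spc unfolding mutually_singular_def by (intro bexI[of _ "space N - B"]) auto
  with nsing show False by simp
qed

section \<open>Haar measure: regularity and continuity of translation\<close>

locale haar_group =
  fixes \<eta> :: "'g::{topological_group_add, second_countable_topology, t2_space} measure"
  assumes lc: "locally_compact_space (euclidean :: 'g topology)"
    and haar: "haar_measure \<eta>"
begin

lemma sets_haar [measurable_cong, simp]: "sets \<eta> = sets borel"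
  and haar_compact: "compact K \<Longrightarrow> emeasure \<eta> K < \<infinity>"
  and haar_distr: "distr \<eta> borel (\<lambda>h. g + h) = \<eta>"
  using haar by (auto simp: haar_measure_def)

lemma space_haar [simp]: "space \<eta> = UNIV"
  using sets_eq_imp_space_eq[OF sets_haar] by simp

lemma nn_integral_haar_translate:
  assumes [measurable]: "f \<in> borel_measurable borel"
  shows "(\<integral>\<^sup>+t. f (g + t) \<partial>\<eta>) = (\<integral>\<^sup>+t. f t \<partial>\<eta>)"
proof -
  have "(\<integral>\<^sup>+t. f t \<partial>\<eta>) = (\<integral>\<^sup>+t. f t \<partial>distr \<eta> borel (\<lambda>h. g + h))" by (simp add: haar_distr)
  also have "\<dots> = (\<integral>\<^sup>+t. f (g + t) \<partial>\<eta>)" by (subst nn_integral_distr) auto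
  finally show ?thesis by simp
qed

lemma compact_translate: "compact K \<Longrightarrow> compact ((\<lambda>t. g + t) ` (K :: 'g set))"
  by (intro compact_continuous_image continuous_intros)

lemma emeasure_haar_translate:
  assumes "compact K" shows "emeasure \<eta> ((\<lambda>t. g + t) ` K) = emeasure \<eta> K"
proof -
  have [measurable]: "(\<lambda>t. g + t) ` K \<in> sets borel"
    using assms by (intro borel_closed compact_imp_closed compact_translate)
  have "emeasure \<eta> ((\<lambda>t. g + t) ` K) = (\<integral>\<^sup>+t. indicator ((\<lambda>t. g + t) ` K) (g + t) \<partial>\<eta>)"
    by (subst nn_integral_haar_translate) auto
  also have "\<dots> = (\<integral>\<^sup>+t. indicator K t \<partial>\<eta>)"
    by (intro nn_integral_cong) (auto simp: indicator_def)
  also have "\<dots> = emeasure \<eta> K" using assms by (simp add: borel_closed compact_imp_closed)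
  finally show ?thesis .
qed

text \<open>Haar measure may be infinite, so the regularity of finite measures is applied to its
  restriction to the compact set \<open>L\<close>. Open sets are F-sigma because they are countable
  unions of compact sets.\<close>

lemma regular_on_compact:
  assumes L: "compact L" and A: "A \<in> sets borel" and e: "0 < e"
  shows "\<exists>C U. closed C \<and> open U \<and> C \<subseteq> A \<and> A \<subseteq> U \<and> emeasure \<eta> (L \<inter> (U - C)) < ennreal e"
proof -
  have [measurable]: "L \<in> sets borel" using L by (intro borel_closed compact_imp_closed)
  have dens: "emeasure (density \<eta> (indicator L)) X = emeasure \<eta> (L \<inter> X)" if "X \<in> sets borel" for X
    using that by (subst emeasure_density) (auto simp: nn_integral_indicator[symmetric] indicator_inter_arith simp del: nn_integral_indicator)
  have "finite_measure (density \<eta> (indicator L))"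
  proof (rule finite_measureI)
    show "emeasure (density \<eta> (indicator L)) (space (density \<eta> (indicator L))) \<noteq> \<infinity>"
      using haar_compact[OF L] by (simp add: dens less_top)
  qed
  then interpret F: finite_measure "density \<eta> (indicator L)" .
  have "fsigma_in euclidean U" if "openin euclidean U" for U :: "'g set"
  proof -
    have "open U" using that by simp
    then obtain K :: "nat \<Rightarrow> 'g set" where "\<forall>n. compact (K n)" "(\<Union>n. K n) = U"
      using locally_compact_second_countable_open_eq_Union_compact[OF lc] by blast
    moreover have "closedin euclidean (K n)" for n
      using compact_imp_closed[of "K n"] calculation by simp
    ultimately show ?thesis unfolding fsigma_in_def union_of_def
      by (intro exI[of _ "range K"]) auto
  qed
  then obtain C U where CU: "closed C" "open U" "C \<subseteq> A" "A \<subseteq> U" "measure (density \<eta> (indicator L)) (U - C) < e"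
    using F.regular_closed_open[of euclidean A e] A e by (auto simp: sets_borel_of_euclidean)
  then have "emeasure (density \<eta> (indicator L)) (U - C) < ennreal e"
    using e by (simp add: F.emeasure_eq_measure ennreal_less_iff)
  then show ?thesis using CU dens[of "U - C"] by (intro exI[of _ C] exI[of _ U]) auto
qed

text \<open>An approximation with error below the measure of \<open>F\<close> leaves a closed subset
  of positive measure, which is compact as a closed part of \<open>L\<close>.\<close>

lemma inner_regular:
  assumes L: "compact L" and F: "F \<in> sets borel" "F \<subseteq> L" "emeasure \<eta> F > 0"
  shows "\<exists>K. compact K \<and> K \<subseteq> F \<and> emeasure \<eta> K > 0"
proof -
  have fin: "emeasure \<eta> F < \<infinity>"
    using haar_compact[OF L] emeasure_mono[of F L \<eta>] F(2) borel_closed[OF compact_imp_closed[OF L]]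
    by (simp add: le_less_trans)
  then have pos: "measure \<eta> F > 0" using F(3) by (simp add: measure_def enn2real_positive_iff)
  obtain C U where CU: "closed C" "open U" "C \<subseteq> F" "F \<subseteq> U" "emeasure \<eta> (L \<inter> (U - C)) < ennreal (measure \<eta> F)"
    using regular_on_compact[OF L F(1) pos] by blast
  have [measurable]: "C \<in> sets borel" "U \<in> sets borel" "L \<in> sets borel"
    using CU L by (auto intro: borel_closed compact_imp_closed)
  have "emeasure \<eta> C \<noteq> 0"
  proof
    assume "emeasure \<eta> C = 0"
    have "emeasure \<eta> F \<le> emeasure \<eta> (C \<union> (L \<inter> (U - C)))" using CU F by (intro emeasure_mono) auto
    also have "\<dots> \<le> emeasure \<eta> C + emeasure \<eta> (L \<inter> (U - C))" by (intro emeasure_subadditive) auto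
    also have "\<dots> < emeasure \<eta> F" using CU(5) \<open>emeasure \<eta> C = 0\<close> fin
      by (simp add: emeasure_eq_ennreal_measure less_top[symmetric])
    finally show False by simp
  qed
  moreover have "compact C"
  proof -
    have "L \<inter> C = C" using CU(3) F(2) by auto
    then show ?thesis using compact_Int_closed[OF L CU(1)] by simp
  qed
  ultimately show ?thesis using CU by (auto simp: zero_less_iff_neq_zero)
qed

text \<open>Continuity of translation in mean, for the indicator of \<open>K\<close>. An open set
  around the translate by \<open>g\<close> with little excess also contains all translates by nearby
  elements, by the tube lemma.\<close>

lemma translate_difference_small:
  assumes K: "compact K" and e: "0 < e"
  shows "\<exists>W. open W \<and> g \<in> W \<and> (\<forall>g'\<in>W. emeasure \<eta> ((\<lambda>t. g + t) ` K - (\<lambda>t. g' + t) ` K) < ennreal e)"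
proof -
  have cK: "compact ((\<lambda>t. g + t) ` K)" for g using K by (rule compact_translate)
  have [measurable]: "(\<lambda>t. g + t) ` K \<in> sets borel" for g using cK by (intro borel_closed compact_imp_closed)
  \<comment> \<open>\<open>L\<close> is a compact set that contains all nearby translates, so that
    regularity is available on it.\<close>
  obtain V L where VL: "open V" "compact L" "(\<lambda>t. g + t) ` K \<subseteq> V" "V \<subseteq> L"
    using locally_compact_compact_open_nhds[OF lc open_UNIV cK[of g] subset_UNIV] by blast
  have "(\<lambda>t. g + t) ` K \<in> sets borel" by measurable
  from regular_on_compact[OF VL(2) this e] obtain C U where CU:
      "closed C" "open U" "C \<subseteq> (\<lambda>t. g + t) ` K" "(\<lambda>t. g + t) ` K \<subseteq> U"
      "emeasure \<eta> (L \<inter> (U - C)) < ennreal e"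
    by metis
  have [measurable]: "C \<in> sets borel" "U \<in> sets borel" "V \<in> sets borel" "L \<in> sets borel"
    using CU VL by (auto intro: borel_closed compact_imp_closed)
  have "open ((\<lambda>p. fst p + snd p) -` (U \<inter> V) :: ('g \<times> 'g) set)"
    using CU VL by (intro open_vimage open_Int continuous_intros)
  then obtain W where W: "g \<in> W" "open W" "W \<times> K \<subseteq> (\<lambda>p. fst p + snd p) -` (U \<inter> V)"
  proof (rule Elementary_Topology.tube_lemma[OF K, THEN exE])
    show "{g} \<times> K \<subseteq> (\<lambda>p. fst p + snd p) -` (U \<inter> V)" using CU(4) VL(3) by auto
  qed auto
  have "emeasure \<eta> ((\<lambda>t. g + t) ` K - (\<lambda>t. g' + t) ` K) < ennreal e" if g': "g' \<in> W" for g'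
  proof -
    let ?A = "(\<lambda>t. g + t) ` K" and ?B = "(\<lambda>t. g' + t) ` K"
    have sub: "?B \<subseteq> U \<inter> V" using W(3) g' by auto
    have fin: "emeasure \<eta> (?A \<inter> ?B) \<noteq> \<infinity>"
      using haar_compact[OF cK[of g]] emeasure_mono[of "?A \<inter> ?B" ?A \<eta>] by (auto simp: top_unique)
    have "emeasure \<eta> (?A - ?B) = emeasure \<eta> (?A - ?A \<inter> ?B)" by (simp add: Diff_Int)
    also have "\<dots> = emeasure \<eta> ?A - emeasure \<eta> (?A \<inter> ?B)" using fin by (intro emeasure_Diff) auto
    \<comment> \<open>By left invariance \<open>?A\<close> and \<open>?B\<close> have equal measure,
      so \<open>?A - ?B\<close> and \<open>?B - ?A\<close> do too; only the latter is controlled by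
      the outer approximation.\<close>
    also have "\<dots> = emeasure \<eta> ?B - emeasure \<eta> (?A \<inter> ?B)" using K by (simp add: emeasure_haar_translate)
    also have "\<dots> = emeasure \<eta> (?B - ?A \<inter> ?B)" using fin by (intro emeasure_Diff[symmetric]) auto
    also have "\<dots> \<le> emeasure \<eta> (L \<inter> (U - C))" using sub CU VL by (intro emeasure_mono) auto
    finally show ?thesis using CU(5) by simp
  qed
  then show ?thesis using W(1,2) by (intro exI[of _ W]) simp
qed

end

section \<open>Bounded harmonic functions of a spread out walk\<close>

text \<open>The elements whose right translation maps \<open>closure Z\<close> into itself form a
  closed semigroup \<open>S\<close> of full measure. Non-degeneracy makes \<open>S\<close> the whole
  group, and translating the point \<open>0\<close> of \<open>Z\<close> reaches everything.\<close>

lemma (in random_walk) dense_of_absorbing: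
  assumes nd: "non_degenerate m" and Z: "0 \<in> Z" "\<And>g. g \<in> Z \<Longrightarrow> AE s in m. g + s \<in> Z"
  shows "closure Z = UNIV"
proof -
  obtain D where D: "countable D" "D \<subseteq> Z" "Z \<subseteq> closure D"
    using countable_dense_subset[of Z] by blast
  have clD: "closure D = closure Z" 
    using closure_mono[OF D(2)] closure_mono[OF D(3)] by simp
  define S where "S = {s. \<forall>z\<in>closure Z. z + s \<in> closure Z}"
  have "S = (\<Inter>z\<in>closure Z. (\<lambda>s. z + s) -` closure Z)" by (auto simp: S_def)
  also have "closed \<dots>" by (intro closed_INT ballI closed_vimage continuous_intros closed_closure)
  finally have closedS: "closed S" .
  have semi: "\<forall>x\<in>S. \<forall>y\<in>S. x + y \<in> S" by (auto simp: S_def add.assoc[symmetric])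
  \<comment> \<open>The exceptional null set depends on \<open>g\<close>, so only countably many
    \<open>g\<close> can be handled at once; continuity extends the conclusion from \<open>D\<close>
    to \<open>closure Z\<close>.\<close>
  have "AE s in m. \<forall>g\<in>D. g + s \<in> Z" using D Z(2) by (subst AE_ball_countable) auto
  then have "AE s in m. s \<in> S"
  proof eventually_elim
    case (elim s)
    have "continuous_on (closure D) (\<lambda>z. z + s)" by (intro continuous_intros)
    moreover have "(\<lambda>z. z + s) ` D \<subseteq> closure Z" using elim closure_subset by blast
    ultimately have "(\<lambda>z. z + s) ` closure D \<subseteq> closure Z"
      by (intro image_closure_subset) auto
    then show ?case using clD by (auto simp: S_def)
  qed
  then have "emeasure m S = 1"
    using closedS by (intro emeasure_eq_1_AE) (auto simp: sets_m)
  then have "\<Inter>{S. closed S \<and> (\<forall>x\<in>S. \<forall>y\<in>S. x + y \<in> S) \<and> emeasure m S = 1} \<subseteq> S"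
    using closedS semi by (intro Inter_lower) auto
  then have "S = UNIV" using nd by (auto simp: non_degenerate_def)
  then have "\<forall>s. 0 + s \<in> closure Z" using Z(1) closure_subset[of Z] unfolding S_def by blast
  then show ?thesis by auto
qed

lemma (in random_walk) harmonic_conv_power:
  fixes h :: "'g \<Rightarrow> ennreal"
  assumes [measurable]: "h \<in> borel_measurable borel"
    and harm: "\<And>g. h g = (\<integral>\<^sup>+s. h (g + s) \<partial>m)"
  shows "h g = (\<integral>\<^sup>+s. h (g + s) \<partial>conv_power m n)"
proof (induction n arbitrary: g)
  case 0
  then show ?case by (simp add: nn_integral_return)
next
  case (Suc n)
  have "(\<integral>\<^sup>+s. h (g + s) \<partial>conv_power m (Suc n)) = (\<integral>\<^sup>+a. \<integral>\<^sup>+b. h (g + (a + b)) \<partial>conv_power m n \<partial>m)"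
    by (rule nn_integral_conv_power_Suc) measurable
  also have "\<dots> = (\<integral>\<^sup>+a. h (g + a) \<partial>m)"
    by (intro nn_integral_cong) (simp add: Suc.IH[symmetric] add.assoc[symmetric])
  finally show ?case using harm[of g] by simp
qed

locale spread_out_walk = random_walk m
  for m :: "'g::{topological_group_add, second_countable_topology, t2_space} measure" +
  assumes lc: "locally_compact_space (euclidean :: 'g topology)"
    and nd: "non_degenerate m" and so: "spread_out m"
begin

text \<open>A quantitative form of being spread out: on some compact set of positive Haar measure,
  Haar measure is dominated by a multiple of a convolution power.\<close>

lemma conv_power_ge_haar:
  "\<exists>\<eta> K n (k :: nat). haar_measure \<eta> \<and> compact K \<and> emeasure \<eta> K > 0 \<and>
    (\<forall>E\<in>sets borel. E \<subseteq> K \<longrightarrow> emeasure \<eta> E \<le> of_nat k * emeasure (conv_power m n) E)"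
proof -
  obtain \<eta> n where \<eta>: "haar_measure \<eta>" and ns: "\<not> mutually_singular (conv_power m n) \<eta>"
    using so by (auto simp: spread_out_def)
  interpret haar_group \<eta> using lc \<eta> by unfold_locales
  interpret P: prob_space "conv_power m n" by (rule prob_space_conv_power)
  obtain L :: "nat \<Rightarrow> 'g set" where L: "\<forall>j. compact (L j)" "(\<Union>j. L j) = UNIV"
    using locally_compact_second_countable_open_eq_Union_compact[OF lc open_UNIV] by blast
  have "\<exists>j k F. F \<in> sets (conv_power m n) \<and> F \<subseteq> L j \<and> emeasure \<eta> F > 0 \<and>
    (\<forall>E\<in>sets (conv_power m n). E \<subseteq> F \<longrightarrow> emeasure \<eta> E \<le> of_nat k * emeasure (conv_power m n) E)"
    using L ns haar_compact
    by (intro not_mutually_singular_imp_le) (auto intro: P.finite_measure_axioms borel_closed compact_imp_closed)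
  then obtain j k F where F: "F \<in> sets borel" "F \<subseteq> L j" "emeasure \<eta> F > 0"
    "\<forall>E\<in>sets borel. E \<subseteq> F \<longrightarrow> emeasure \<eta> E \<le> of_nat k * emeasure (conv_power m n) E"
    unfolding sets_conv_power by blast
  obtain K where K: "compact K" "K \<subseteq> F" "emeasure \<eta> K > 0"
    using inner_regular[OF _ F(1,2,3)] L(1) by auto
  show ?thesis
    by (rule exI[of _ \<eta>], rule exI[of _ K], rule exI[of _ n], rule exI[of _ k])
       (use \<eta> K F(4) in \<open>simp add: order_trans[OF _ K(2)]\<close>)
qed

text \<open>Averaging \<open>h\<close> over translates of a compact set depends continuously on the translate, and
  vanishes at the zeros of \<open>h\<close>, which are dense.\<close>

lemma nonneg_harmonic_eq_0:
  fixes h :: "'g \<Rightarrow> ennreal"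
  assumes h[measurable]: "h \<in> borel_measurable borel" and le1: "\<And>g. h g \<le> 1"
    and harm: "\<And>g. h g = (\<integral>\<^sup>+s. h (g + s) \<partial>m)" and h0: "h 0 = 0"
  shows "h g = 0"
proof -
  obtain \<eta> K n and k :: nat where \<eta>: "haar_measure \<eta>" and K: "compact K" "emeasure \<eta> K > 0"
    and ge': "\<forall>E\<in>sets borel. E \<subseteq> K \<longrightarrow> emeasure \<eta> E \<le> of_nat k * emeasure (conv_power m n) E"
    using conv_power_ge_haar by blast
  note ge = ge'[rule_format]
  interpret haar_group \<eta> using lc \<eta> by unfold_locales
  interpret P: prob_space "conv_power m n" by (rule prob_space_conv_power)
  have [measurable]: "K \<in> sets borel" using K by (intro borel_closed compact_imp_closed)
  note harm_n = harmonic_conv_power[OF h harm, of _ n]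
  define Z where "Z = {g. h g = 0}"
  \<comment> \<open>A nonnegative function with mean zero vanishes almost surely, so from a zero of
    \<open>h\<close> the walk steps almost surely to another zero.\<close>
  have "closure Z = UNIV"
  proof (rule dense_of_absorbing[OF nd])
    show "0 \<in> Z" using h0 by (simp add: Z_def)
    fix g assume "g \<in> Z"
    then have "(\<integral>\<^sup>+s. h (g + s) \<partial>m) = 0" using harm[of g] by (simp add: Z_def)
    then show "AE s in m. g + s \<in> Z" by (subst (asm) nn_integral_0_iff_AE) (auto simp: Z_def)
  qed
  define q where "q g = (\<integral>\<^sup>+t. h t * indicator ((\<lambda>t. g + t) ` K) t \<partial>\<eta>)" for g
  have gK[measurable]: "(\<lambda>t. g + t) ` K \<in> sets borel" for g
    using K by (intro borel_closed compact_imp_closed compact_translate)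
  have q_eq: "q g = (\<integral>\<^sup>+t. h (g + t) * indicator K t \<partial>\<eta>)" for g
  proof -
    have "q g = (\<integral>\<^sup>+t. h (g + t) * indicator ((\<lambda>t. g + t) ` K) (g + t) \<partial>\<eta>)"
      unfolding q_def by (rule nn_integral_haar_translate[symmetric]) measurable
    also have "\<dots> = (\<integral>\<^sup>+t. h (g + t) * indicator K t \<partial>\<eta>)"
      by (intro nn_integral_cong) (auto simp: indicator_def)
    finally show ?thesis .
  qed
  \<comment> \<open>At a zero of \<open>h\<close> the function \<open>h (z + s)\<close> vanishes for
    almost every \<open>s\<close> under the convolution power, hence by \<open>ge\<close>
    Haar-almost everywhere on \<open>K\<close>.\<close>
  have q0: "q z = 0" if "z \<in> Z" for z
  proof -
    have "(\<integral>\<^sup>+s. h (z + s) \<partial>conv_power m n) = 0" using that harm_n[of z] by (simp add: Z_def)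
    then have "AE s in conv_power m n. h (z + s) = 0" by (subst (asm) nn_integral_0_iff_AE) auto
    then have "emeasure (conv_power m n) {s. h (z + s) \<noteq> 0} = 0"
      by (subst (asm) AE_iff_measurable[OF _ refl]) auto
    then have "emeasure (conv_power m n) {s\<in>K. h (z + s) \<noteq> 0} = 0"
      by (rule emeasure_eq_0[rotated]) auto
    then have "emeasure \<eta> {s\<in>K. h (z + s) \<noteq> 0} \<le> of_nat k * 0"
      using ge[of "{s\<in>K. h (z + s) \<noteq> 0}"] by simp
    then have "{s\<in>K. h (z + s) \<noteq> 0} \<in> null_sets \<eta>" by (auto simp: null_sets_def)
    then have "AE t in \<eta>. h (z + t) * indicator K t = 0"
      by (rule AE_I') (auto simp: indicator_def)
    then show ?thesis unfolding q_eq by (subst nn_integral_0_iff_AE) auto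
  qed
  have q_all: "q g = 0" for g
  proof (rule ccontr)
    assume nz: "q g \<noteq> 0"
    have "q g \<le> (\<integral>\<^sup>+t. indicator ((\<lambda>t. g + t) ` K) t \<partial>\<eta>)"
      unfolding q_def using le1 by (intro nn_integral_mono) (auto simp: indicator_def)
    also have "\<dots> < \<infinity>" using haar_compact[OF compact_translate[OF K(1)]] by simp
    finally have fin: "q g < \<infinity>" .
    define e where "e = enn2real (q g)"
    have e: "0 < e" "q g = ennreal e" using fin nz
      by (auto simp: e_def enn2real_positive_iff zero_less_iff_neq_zero)
    obtain W where W: "open W" "g \<in> W" "\<forall>g'\<in>W. emeasure \<eta> ((\<lambda>t. g + t) ` K - (\<lambda>t. g' + t) ` K) < ennreal e"
      using translate_difference_small[OF K(1) e(1)] by meson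
    have "g \<in> closure Z" using \<open>closure Z = UNIV\<close> by simp
    then obtain z where z: "z \<in> Z" "z \<in> W"
      using W(1,2) open_Int_closure_eq_empty[OF W(1), of Z] by blast
    have "q g \<le> (\<integral>\<^sup>+t. h t * indicator ((\<lambda>t. z + t) ` K) t + indicator ((\<lambda>t. g + t) ` K - (\<lambda>t. z + t) ` K) t \<partial>\<eta>)"
      unfolding q_def using le1 by (intro nn_integral_mono) (auto simp: indicator_def)
    also have "\<dots> = q z + emeasure \<eta> ((\<lambda>t. g + t) ` K - (\<lambda>t. z + t) ` K)"
      unfolding q_def by (subst nn_integral_add) auto
    also have "\<dots> < ennreal e" using q0[OF z(1)] W(3) z(2) by simp
    finally show False using e by simp
  qed
  have finK: "emeasure \<eta> K = ennreal (measure \<eta> K)"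
    using haar_compact[OF K(1)] by (intro emeasure_eq_ennreal_measure) simp
  have ge_real: "measure \<eta> K \<le> real k * measure (conv_power m n) F"
    if "F \<in> sets borel" "emeasure \<eta> K \<le> of_nat k * emeasure (conv_power m n) F" for F
    using that(2) by (simp add: finK P.emeasure_eq_measure ennreal_of_nat_eq_real_of_nat ennreal_mult'[symmetric])
  have "k \<noteq> 0" using ge[of K] K(2) by (intro notI) simp
  \<comment> \<open>\<open>c\<close> bounds from below the mass that the \<open>n\<close>-step law
    gives to any Borel subset of \<open>K\<close> of full Haar measure.\<close>
  define c where "c = measure \<eta> K / real k"
  have "c > 0" using K(2) \<open>k \<noteq> 0\<close> by (simp add: c_def finK)
  moreover have "c \<le> measure (conv_power m n) K"
    using ge_real[of K] ge[of K] \<open>k \<noteq> 0\<close> by (simp add: c_def field_simps)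
  moreover note P.prob_le_1[of K]
  ultimately have c: "c > 0" "c \<le> 1" by linarith+
  \<comment> \<open>Since \<open>q\<close> vanishes everywhere, the walk started at any
    \<open>g\<close> is at a zero of \<open>h\<close> after \<open>n\<close> steps with probability
    at least \<open>c\<close>. Each block of \<open>n\<close> steps therefore shrinks the uniform
    bound on \<open>h\<close> by the factor \<open>1 - c\<close>.\<close>
  have bound: "h g \<le> ennreal ((1 - c) ^ j)" for g j
  proof (induction j arbitrary: g)
    case 0
    then show ?case using le1 by simp
  next
    case (Suc j)
    have "AE t in \<eta>. h (g + t) * indicator K t = 0"
      using q_all[of g] unfolding q_eq by (subst (asm) nn_integral_0_iff_AE) auto
    then have "emeasure \<eta> {t. h (g + t) * indicator K t \<noteq> 0} = 0"
      by (subst (asm) AE_iff_measurable[OF _ refl]) auto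
    then have \<eta>0: "emeasure \<eta> {t\<in>K. h (g + t) \<noteq> 0} = 0"
      by (rule emeasure_eq_0[rotated]) auto
    define F where "F = {t\<in>K. h (g + t) = 0}"
    have [measurable]: "F \<in> sets borel" unfolding F_def by measurable
    have "emeasure \<eta> K \<le> emeasure \<eta> F + emeasure \<eta> {t\<in>K. h (g + t) \<noteq> 0}"
      by (rule order_trans[OF emeasure_mono emeasure_subadditive]) (auto simp: F_def)
    also have "\<dots> \<le> of_nat k * emeasure (conv_power m n) F"
      using ge[of F] \<eta>0 by (simp add: F_def subset_iff)
    finally have "c \<le> measure (conv_power m n) F"
      using ge_real[of F] \<open>k \<noteq> 0\<close> by (simp add: c_def field_simps)
    then have cF: "measure (conv_power m n) (UNIV - F) \<le> 1 - c"
      using P.prob_compl[of F] by simp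
    have "h g = (\<integral>\<^sup>+s. h (g + s) \<partial>conv_power m n)" by (rule harm_n)
    also have "\<dots> \<le> (\<integral>\<^sup>+s. ennreal ((1 - c) ^ j) * indicator (UNIV - F) s \<partial>conv_power m n)"
    proof (intro nn_integral_mono)
      fix s
      show "h (g + s) \<le> ennreal ((1 - c) ^ j) * indicator (UNIV - F) s"
      proof (cases "s \<in> F")
        case True then show ?thesis by (simp add: F_def)
      next
        case False then show ?thesis using Suc.IH[of "g + s"] by simp
      qed
    qed
    also have "\<dots> = ennreal ((1 - c) ^ j) * emeasure (conv_power m n) (UNIV - F)"
      by (rule nn_integral_cmult_indicator) simp
    also have "\<dots> = ennreal ((1 - c) ^ j * measure (conv_power m n) (UNIV - F))"
      using c by (simp add: P.emeasure_eq_measure ennreal_mult')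
    also have "\<dots> \<le> ennreal ((1 - c) ^ Suc j)"
      using cF c by (intro ennreal_leI) (metis diff_ge_0_iff_ge mult_left_mono power_Suc2 zero_le_power)
    finally show ?case .
  qed
  show ?thesis
  proof (rule ccontr)
    assume "h g \<noteq> 0"
    have "(\<lambda>j. ennreal ((1 - c) ^ j)) \<longlonglongrightarrow> ennreal 0"
      using c by (intro tendsto_ennrealI LIMSEQ_realpow_zero) auto
    then have "h g \<le> ennreal 0" by (rule LIMSEQ_le_const) (use bound in auto)
    with \<open>h g \<noteq> 0\<close> show False by simp
  qed
qed

end

section \<open>Quasi-invariance of the stationary measure\<close>

locale nonsingular_action = stationary_action m act \<mu> + spread_out_walk m
  for m :: "'g::{topological_group_add, second_countable_topology, t2_space} measure"
    and act :: "'g \<Rightarrow> 'x \<Rightarrow> 'x" and \<mu>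
begin

text \<open>Stationarity applied to the function \<open>indicator A (act g x)\<close> of
  \<open>x\<close> makes \<open>h\<close> harmonic, and \<open>nonneg_harmonic_eq_0\<close>
  concludes.\<close>

lemma emeasure_act_null:
  assumes A[measurable]: "A \<in> sets \<mu>" and null: "emeasure \<mu> A = 0"
  shows "emeasure \<mu> {x\<in>space \<mu>. act g x \<in> A} = 0"
proof -
  define h :: "'g \<Rightarrow> ennreal" where "h g = (\<integral>\<^sup>+x. indicator A (act g x) \<partial>\<mu>)" for g
  have h: "h g = emeasure \<mu> {x\<in>space \<mu>. act g x \<in> A}" for g
  proof -
    have "h g = (\<integral>\<^sup>+x. indicator {x\<in>space \<mu>. act g x \<in> A} x \<partial>\<mu>)"
      unfolding h_def by (intro nn_integral_cong) (auto simp: indicator_def)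
    then show ?thesis by simp
  qed
  have "h g = 0"
  proof (rule nonneg_harmonic_eq_0)
    show "h \<in> borel_measurable borel" unfolding h_def by measurable
    show "h g \<le> 1" for g unfolding h by (rule \<mu>.emeasure_le_1)
    have "h 0 = (\<integral>\<^sup>+x. indicator A x \<partial>\<mu>)" unfolding h_def by (intro nn_integral_cong) simp
    then show "h 0 = 0" using null by simp
    show "h g = (\<integral>\<^sup>+s. h (g + s) \<partial>m)" for g
    proof -
      have "(\<integral>\<^sup>+s. h (g + s) \<partial>m) = (\<integral>\<^sup>+s. \<integral>\<^sup>+x. indicator A (act g (act s x)) \<partial>\<mu> \<partial>m)"
        unfolding h_def by (intro nn_integral_cong) (simp add: act_add)
      also have "\<dots> = h g" unfolding h_def by (rule nn_integral_stationary_1) measurable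
      finally show ?thesis by simp
    qed
  qed
  then show ?thesis by (simp add: h)
qed

lemma AE_act:
  assumes "AE x in \<mu>. P x" shows "AE x in \<mu>. P (act g x)"
proof -
  obtain N where N: "{x\<in>space \<mu>. \<not> P x} \<subseteq> N" "emeasure \<mu> N = 0" "N \<in> sets \<mu>"
    using assms by (rule AE_E)
  then have "{x\<in>space \<mu>. act g x \<in> N} \<in> null_sets \<mu>"
    using emeasure_act_null[OF N(3,2)] by (auto simp: null_sets_def)
  then show ?thesis by (rule AE_I') (use N(1) in auto)
qed

lemma nonsingular: "nonsingular_system act \<mu>"
  using \<mu>.prob_space_axioms emeasure_act_null by (rule nonsingular_systemI)

end

section \<open>Contraction to point masses\<close>

context nonsingular_action
begin

text \<open>This is \<open>p A g\<close> of the overview. It is real-valued so that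
  \<open>hit A g * (1 - hit A g)\<close>, the variance of the indicator of \<open>A\<close> under
  the measure pushed by \<open>g\<close>, involves ordinary subtraction.\<close>

definition hit :: "'x set \<Rightarrow> 'g \<Rightarrow> real" where
  "hit A g = measure \<mu> {x\<in>space \<mu>. act g x \<in> A}"

lemma hit_bounds [simp]: "0 \<le> hit A g" "hit A g \<le> 1"
  by (simp_all add: hit_def)

lemma ennreal_hit: "ennreal (hit A g) = emeasure \<mu> {x\<in>space \<mu>. act g x \<in> A}"
  by (simp add: hit_def \<mu>.emeasure_eq_measure)

lemma ennreal_hit_nn_integral:
  assumes [measurable]: "A \<in> sets \<mu>"
  shows "ennreal (hit A g) = (\<integral>\<^sup>+x. indicator A (act g x) \<partial>\<mu>)"
proof -
  have "(\<integral>\<^sup>+x. indicator A (act g x) \<partial>\<mu>) = (\<integral>\<^sup>+x. indicator {x\<in>space \<mu>. act g x \<in> A} x \<partial>\<mu>)"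
    by (intro nn_integral_cong) (auto simp: indicator_def)
  then show ?thesis by (simp add: ennreal_hit)
qed

lemma measurable_hit [measurable]:
  assumes [measurable]: "A \<in> sets \<mu>" shows "hit A \<in> borel_measurable borel"
proof -
  have "(\<lambda>g. enn2real (\<integral>\<^sup>+x. indicator A (act g x) \<partial>\<mu>)) \<in> borel_measurable borel" by measurable
  then show ?thesis by (simp add: ennreal_hit_nn_integral[symmetric])
qed

lemma nn_integral_hit:
  assumes [measurable]: "A \<in> sets \<mu>"
  shows "(\<integral>\<^sup>+g. ennreal (hit A g) \<partial>conv_power m n) = emeasure \<mu> A"
  unfolding ennreal_hit_nn_integral[OF assms] by (subst nn_integral_stationary) auto

text \<open>By quasi-invariance a null change of \<open>A\<close> is invisible for every
  \<open>g\<close>. This permits the passage to a topological model, which is isomorphic to the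
  system only modulo null sets.\<close>

lemma hit_cong_AE:
  assumes [measurable]: "A \<in> sets \<mu>" "B \<in> sets \<mu>" and eq: "AE x in \<mu>. x \<in> A \<longleftrightarrow> x \<in> B"
  shows "hit A g = hit B g"
  unfolding hit_def using AE_act[OF eq, of g]
  by (intro \<mu>.finite_measure_eq_AE) auto

text \<open>For a continuous \<open>f\<close> the variance under the pushed measures tends to that
  of a point mass, namely 0, along almost every path. Replacing the indicator of \<open>A\<close> by
  \<open>f\<close> costs a multiple of \<open>h (U - C)\<close>, whose mean is by stationarity the
  same small number at every time \<open>n\<close>.\<close>

lemma hit_variance_tendsto_0_of_model:
  fixes T :: "'y topology"
  assumes model: "topological_model act \<mu> T b_act \<nu>"
    and prox: "AE \<omega> in (\<Pi>\<^sub>M i\<in>(UNIV :: nat set). m).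
           \<exists>y\<in>topspace T. weak_star_limit T (\<lambda>n. distr \<nu> \<nu> (b_act (walk \<omega> n))) (return \<nu> y)"
    and A [measurable]: "A \<in> sets \<mu>"
  shows "(\<lambda>n. \<integral>g. hit A g * (1 - hit A g) \<partial>conv_power m n) \<longlonglongrightarrow> 0"
proof -
  have T: "compact_space T" "metrizable_space T" and sp: "space \<nu> = topspace T"
    and sets: "sets \<nu> = sets (borel_of T)" and std: "standard_borel_G_space b_act \<nu>"
    using model unfolding topological_model_def by simp_all
  obtain \<phi> \<psi> where \<phi>[measurable]: "\<phi> \<in> measurable \<mu> \<nu>" and \<psi>[measurable]: "\<psi> \<in> measurable \<nu> \<mu>"
    and dist: "distr \<mu> \<nu> \<phi> = \<nu>" and inv: "AE x in \<mu>. \<psi> (\<phi> x) = x"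
    and equi: "\<And>g. AE x in \<mu>. \<phi> (act g x) = b_act g (\<phi> x)"
    using model unfolding topological_model_def by blast
  interpret B: measurable_action b_act \<nu> using std by unfold_locales
  interpret \<nu>: prob_space \<nu> using \<mu>.prob_space_distr[OF \<phi>] dist by simp
  interpret S: sequence_space m by unfold_locales
  \<comment> \<open>The counterpart of \<open>hit\<close> in the model.\<close>
  define h where "h E g = measure \<nu> {y\<in>space \<nu>. b_act g y \<in> E}" for E g
  have h_hit: "h E g = hit (\<phi> -` E \<inter> space \<mu>) g" if [measurable]: "E \<in> sets \<nu>" for E g
  proof -
    have "h E g = measure (distr \<mu> \<nu> \<phi>) {y\<in>space \<nu>. b_act g y \<in> E}" by (simp add: dist h_def)
    also have "\<dots> = measure \<mu> (\<phi> -` {y\<in>space \<nu>. b_act g y \<in> E} \<inter> space \<mu>)"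
      by (rule measure_distr) measurable
    also have "\<dots> = hit (\<phi> -` E \<inter> space \<mu>) g"
      unfolding hit_def using equi[of g]
      by (intro \<mu>.finite_measure_eq_AE) (auto intro: measurable_space[OF \<phi>])
    finally show ?thesis .
  qed
  define A' where "A' = \<psi> -` A \<inter> space \<nu>"
  have A'[measurable]: "A' \<in> sets \<nu>" by (simp add: A'_def)
  have hA: "hit A g = h A' g" for g
    unfolding h_hit[OF A'] using inv
    by (intro hit_cong_AE) (auto simp: A'_def dest: measurable_space[OF \<phi>])
  show ?thesis
  proof (rule LIMSEQ_I)
    fix r :: real assume "0 < r"
    \<comment> \<open>One \<open>e\<close> is for the variance of \<open>f\<close>, three are for
      the approximation error in \<open>main\<close>.\<close>
    define e where "e = r / 4"
    have e: "0 < e" "r = 4 * e" using \<open>0 < r\<close> by (auto simp: e_def)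
    obtain C U where CU: "closedin T C" "openin T U" "C \<subseteq> A'" "A' \<subseteq> U" "measure \<nu> (U - C) < e"
      using \<nu>.regular_closed_open[OF sets open_imp_fsigma_in[OF T(2)] A' e(1)] by blast
    have [measurable]: "C \<in> sets \<nu>" "U \<in> sets \<nu>"
      using CU by (auto simp: sets intro: borel_of_closedin borel_of_openin)
    have "closedin T (topspace T - U)" "disjnt (topspace T - U) C"
      using CU by (auto simp: disjnt_def)
    \<comment> \<open>\<open>f\<close> is 1 on \<open>C\<close> and 0 off \<open>U\<close>, so
      \<open>f\<close> and its square both differ from the indicator of \<open>A'\<close> only on
      \<open>U - C\<close>.\<close>
    then obtain f :: "'y \<Rightarrow> real" where f: "continuous_map T (top_of_set {0..1}) f"
      "f ` (topspace T - U) \<subseteq> {0}" "f ` C \<subseteq> {1}"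
      using Urysohn_lemma[OF metrizable_imp_normal_space[OF T(2)], of "topspace T - U" C 0 1] CU(1) by auto
    have fc: "continuous_map T euclideanreal f" and f01: "\<And>y. y \<in> topspace T \<Longrightarrow> f y \<in> {0..1}"
      using f(1) by (auto simp: continuous_map_in_subtopology)
    have fc2: "continuous_map T euclideanreal (\<lambda>y. (f y)\<^sup>2)"
      using fc by (intro continuous_map_real_pow)
    have [measurable]: "f \<in> borel_measurable \<nu>" using fc sets by (rule continuous_map_borel_measurable)
    have fb: "0 \<le> f y" "f y \<le> 1" "0 \<le> (f y)\<^sup>2" "(f y)\<^sup>2 \<le> 1" if "y \<in> space \<nu>" for y
      using f01[of y] that sp by (auto simp: power_le_one)
    \<comment> \<open>First and second moments of \<open>f\<close> under the measure pushed by
      \<open>g\<close>; \<open>c2 g - (c g)\<^sup>2\<close> is the variance.\<close>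
    define c c2 where "c g = (\<integral>y. f (b_act g y) \<partial>\<nu>)" and "c2 g = (\<integral>y. (f (b_act g y))\<^sup>2 \<partial>\<nu>)" for g
    have int: "integrable \<nu> (\<lambda>y. f (b_act g y))" "integrable \<nu> (\<lambda>y. (f (b_act g y))\<^sup>2)" for g
      by (rule \<nu>.integrable_const_bound[of _ 1], use fb in auto)+
    have c01: "0 \<le> c g" "c g \<le> 1" "0 \<le> c2 g" "c2 g \<le> 1" for g
    proof -
      show "0 \<le> c g" "0 \<le> c2 g" unfolding c_def c2_def
        using fb by (auto intro!: Bochner_Integration.integral_nonneg_AE AE_I2)
      show "c g \<le> 1" "c2 g \<le> 1" unfolding c_def c2_def
        using fb int by (auto intro!: \<nu>.integral_le_const AE_I2)
    qed
    have [measurable]: "c \<in> borel_measurable borel" "c2 \<in> borel_measurable borel"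
      unfolding c_def c2_def by measurable
    have hm[measurable]: "h E \<in> borel_measurable borel" if [measurable]: "E \<in> sets \<nu>" for E
      using measurable_hit[of "\<phi> -` E \<inter> space \<mu>"] by (simp add: h_hit[OF that, abs_def])
    have h_int: "h E g = (\<integral>y. indicator E (b_act g y) \<partial>\<nu>)" if [measurable]: "E \<in> sets \<nu>" for E g
    proof -
      have "(\<integral>y. indicator E (b_act g y) \<partial>\<nu>) = (\<integral>y. (indicator {y\<in>space \<nu>. b_act g y \<in> E} y :: real) \<partial>\<nu>)"
        by (intro Bochner_Integration.integral_cong) (auto simp: indicator_def)
      moreover have "{y\<in>space \<nu>. b_act g y \<in> E} \<in> sets \<nu>" by measurable
      ultimately show ?thesis by (simp add: h_def)
    qed
    have int_ind: "integrable \<nu> (\<lambda>y. indicator E (b_act g y) :: real)" if [measurable]: "E \<in> sets \<nu>" for E g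
      by (rule \<nu>.integrable_const_bound[of _ 1]) auto
    have pt: "\<bar>indicator A' y - f y\<bar> \<le> indicator (U - C) y" "\<bar>indicator A' y - (f y)\<^sup>2\<bar> \<le> (indicator (U - C) y :: real)"
      if "y \<in> space \<nu>" for y
    proof -
      have "f y = 1" if "y \<in> C" using f(3) that by auto
      moreover have "f y = 0" if "y \<notin> U" using f(2) that \<open>y \<in> space \<nu>\<close> sp by auto
      ultimately consider "y \<in> C" "y \<in> A'" "f y = 1" | "y \<notin> U" "y \<notin> A'" "f y = 0" | "y \<in> U - C"
        using CU(3,4) by (cases "y \<in> C"; cases "y \<in> U") auto
      note cases = this
      show "\<bar>indicator A' y - f y\<bar> \<le> (indicator (U - C) y :: real)"
        using fb[OF that] by (cases rule: cases) (auto simp: indicator_def)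
      show "\<bar>indicator A' y - (f y)\<^sup>2\<bar> \<le> (indicator (U - C) y :: real)"
        using fb[OF that] by (cases rule: cases) (auto simp: indicator_def)
    qed
    have close1: "\<bar>h A' g - c g\<bar> \<le> h (U - C) g" for g
    proof -
      have "h A' g - c g = (\<integral>y. indicator A' (b_act g y) - f (b_act g y) \<partial>\<nu>)"
        unfolding c_def h_int[OF A'] by (subst Bochner_Integration.integral_diff) (use int int_ind in auto)
      also have "\<bar>\<dots>\<bar> \<le> (\<integral>y. indicator (U - C) (b_act g y) \<partial>\<nu>)"
        by (rule integral_abs_bound[THEN order_trans], rule integral_mono)
           (use int int_ind pt in \<open>auto intro!: Bochner_Integration.integrable_abs Bochner_Integration.integrable_diff\<close>)
      finally show ?thesis by (simp add: h_int)
    qed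
    have close2: "\<bar>h A' g - c2 g\<bar> \<le> h (U - C) g" for g
    proof -
      have "h A' g - c2 g = (\<integral>y. indicator A' (b_act g y) - (f (b_act g y))\<^sup>2 \<partial>\<nu>)"
        unfolding c2_def h_int[OF A'] by (subst Bochner_Integration.integral_diff) (use int int_ind in auto)
      also have "\<bar>\<dots>\<bar> \<le> (\<integral>y. indicator (U - C) (b_act g y) \<partial>\<nu>)"
        by (rule integral_abs_bound[THEN order_trans], rule integral_mono)
           (use int int_ind pt in \<open>auto intro!: Bochner_Integration.integrable_abs Bochner_Integration.integrable_diff\<close>)
      finally show ?thesis by (simp add: h_int)
    qed
    \<comment> \<open>An indicator equals its square, so \<open>hit\<close> is compared with
      \<open>c2\<close> at the cost of one \<open>h (U - C) g\<close>. The squares of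
      \<open>hit\<close> and \<open>c\<close> differ by at most two more, since both numbers are at
      most 1.\<close>
    have main: "hit A g * (1 - hit A g) \<le> (c2 g - (c g)\<^sup>2) + 3 * h (U - C) g" for g
    proof -
      have "(c g)\<^sup>2 - (hit A g)\<^sup>2 = (c g - hit A g) * (c g + hit A g)" by (simp add: power2_eq_square algebra_simps)
      also have "\<dots> \<le> \<bar>c g - hit A g\<bar> * (c g + hit A g)"
        using c01(1)[of g] hit_bounds(1)[of A g] by (intro mult_right_mono) auto
      also have "\<dots> \<le> \<bar>c g - hit A g\<bar> * 2"
        using add_mono[OF c01(2)[of g] hit_bounds(2)[of A g]] by (intro mult_left_mono) auto
      also have "\<dots> \<le> 2 * h (U - C) g" using close1[of g] by (simp add: hA abs_minus_commute)
      finally show ?thesis using close2[of g] by (simp add: hA power2_eq_square algebra_simps)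
    qed
    have lim: "(\<lambda>n. \<integral>\<omega>. c2 (walk \<omega> n) - (c (walk \<omega> n))\<^sup>2 \<partial>S.S) \<longlonglongrightarrow> (\<integral>\<omega>. 0 \<partial>S.S)"
    proof (rule integral_dominated_convergence[where w="\<lambda>_. 1"])
      show "AE \<omega> in S.S. norm (c2 (walk \<omega> n) - (c (walk \<omega> n))\<^sup>2) \<le> 1" for n
      proof (rule AE_I2)
        fix \<omega>
        have "(c (walk \<omega> n))\<^sup>2 \<le> 1" using c01 by (simp add: power_le_one)
        then show "norm (c2 (walk \<omega> n) - (c (walk \<omega> n))\<^sup>2) \<le> 1"
          using c01(3,4)[of "walk \<omega> n"] zero_le_power2[of "c (walk \<omega> n)"]
          unfolding real_norm_def abs_le_iff by linarith
      qed
      show "AE \<omega> in S.S. (\<lambda>n. c2 (walk \<omega> n) - (c (walk \<omega> n))\<^sup>2) \<longlonglongrightarrow> 0"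
        using prox
      proof eventually_elim
        case (elim \<omega>)
        then obtain y where y: "y \<in> topspace T"
          and w: "weak_star_limit T (\<lambda>n. distr \<nu> \<nu> (b_act (walk \<omega> n))) (return \<nu> y)" by blast
        have L: "(\<lambda>n. \<integral>z. k (b_act (walk \<omega> n) z) \<partial>\<nu>) \<longlonglongrightarrow> k y" if k: "continuous_map T euclideanreal k" for k
        proof -
          have km[measurable]: "k \<in> borel_measurable \<nu>" using k sets by (rule continuous_map_borel_measurable)
          have "(\<lambda>n. \<integral>z. k z \<partial>distr \<nu> \<nu> (b_act (walk \<omega> n))) \<longlonglongrightarrow> (\<integral>z. k z \<partial>return \<nu> y)"
            using w k by (auto simp: weak_star_limit_def)
          moreover have "(\<integral>z. k z \<partial>return \<nu> y) = k y" using y sp km by (intro integral_return) auto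
          moreover have "(\<integral>z. k z \<partial>distr \<nu> \<nu> (b_act g)) = (\<integral>z. k (b_act g z) \<partial>\<nu>)" for g
            by (rule integral_distr) measurable
          ultimately show ?thesis by simp
        qed
        \<comment> \<open>Weak-* convergence is used for the two continuous functions
          \<open>f\<close> and its square.\<close>
        have "(\<lambda>n. c2 (walk \<omega> n) - (c (walk \<omega> n))\<^sup>2) \<longlonglongrightarrow> (f y)\<^sup>2 - (f y)\<^sup>2"
          unfolding c_def c2_def by (intro tendsto_diff tendsto_power L fc fc2)
        then show ?case by simp
      qed
    qed auto
    have tr: "(\<integral>\<omega>. c2 (walk \<omega> n) - (c (walk \<omega> n))\<^sup>2 \<partial>S.S) = (\<integral>g. c2 g - (c g)\<^sup>2 \<partial>conv_power m n)" for n
      by (subst distr_walk[symmetric], subst integral_distr) auto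
    have "(\<lambda>n. \<integral>g. c2 g - (c g)\<^sup>2 \<partial>conv_power m n) \<longlonglongrightarrow> 0" using lim by (simp add: tr)
    then obtain N where N: "\<And>n. n \<ge> N \<Longrightarrow> norm (\<integral>g. c2 g - (c g)\<^sup>2 \<partial>conv_power m n) < e"
      using LIMSEQ_D[OF _ e(1)] by fastforce
    show "\<exists>N. \<forall>n\<ge>N. norm ((\<integral>g. hit A g * (1 - hit A g) \<partial>conv_power m n) - 0) < r"
    proof (intro exI[of _ N] allI impI)
      fix n assume "N \<le> n"
      interpret P: prob_space "conv_power m n" by (rule prob_space_conv_power)
      have UC[measurable]: "U - C \<in> sets \<nu>" by simp
      have h01: "0 \<le> h (U - C) g" "h (U - C) g \<le> 1" for g by (simp_all add: h_def)
      have ihit: "integrable (conv_power m n) (h (U - C))"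
        by (rule P.integrable_const_bound[of _ 1]) (use h01 in auto)
      \<comment> \<open>Stationarity: the mean of the error term does not depend on
        \<open>n\<close>.\<close>
      have "ennreal (\<integral>g. h (U - C) g \<partial>conv_power m n) = (\<integral>\<^sup>+g. ennreal (h (U - C) g) \<partial>conv_power m n)"
        using h01 ihit by (intro nn_integral_eq_integral[symmetric]) auto
      also have "\<dots> = emeasure \<mu> (\<phi> -` (U - C) \<inter> space \<mu>)"
        unfolding h_hit[OF UC] by (rule nn_integral_hit) measurable
      also have "\<dots> = emeasure (distr \<mu> \<nu> \<phi>) (U - C)" by (simp add: emeasure_distr)
      also have "\<dots> = ennreal (measure \<nu> (U - C))" by (simp add: dist \<nu>.emeasure_eq_measure)
      finally have hUC: "(\<integral>g. h (U - C) g \<partial>conv_power m n) = measure \<nu> (U - C)"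
        using h01 by (subst (asm) ennreal_inj) (auto intro!: Bochner_Integration.integral_nonneg)
      have icc: "integrable (conv_power m n) (\<lambda>g. c2 g - (c g)\<^sup>2)"
        by (intro Bochner_Integration.integrable_diff P.integrable_const_bound[of _ 1])
           (use c01 in \<open>auto simp: power_le_one\<close>)
      have hp: "0 \<le> hit A g * (1 - hit A g)" "hit A g * (1 - hit A g) \<le> 1" for g
        using hit_bounds[of A g] by (auto intro!: mult_le_one)
      have iA: "integrable (conv_power m n) (\<lambda>g. hit A g * (1 - hit A g))"
        by (rule P.integrable_const_bound[of _ 1]) (use hp in auto)
      have "(\<integral>g. hit A g * (1 - hit A g) \<partial>conv_power m n) \<le>
          (\<integral>g. (c2 g - (c g)\<^sup>2) + 3 * h (U - C) g \<partial>conv_power m n)"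
        using main icc ihit iA by (intro integral_mono) auto
      also have "\<dots> = (\<integral>g. c2 g - (c g)\<^sup>2 \<partial>conv_power m n) + 3 * measure \<nu> (U - C)"
        using icc ihit by (simp add: hUC)
      also have "\<dots> < r" using N[OF \<open>N \<le> n\<close>] CU(5) e(2) by auto
      finally have "(\<integral>g. hit A g * (1 - hit A g) \<partial>conv_power m n) < r" .
      moreover have "0 \<le> (\<integral>g. hit A g * (1 - hit A g) \<partial>conv_power m n)"
        using hp by (intro Bochner_Integration.integral_nonneg) auto
      ultimately show "norm ((\<integral>g. hit A g * (1 - hit A g) \<partial>conv_power m n) - 0) < r" by simp
    qed
  qed
qed

lemma hit_variance_tendsto_0:
  assumes prox: "m_proximal TYPE('y) m act \<mu>" and A [measurable]: "A \<in> sets \<mu>"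
  shows "(\<lambda>n. \<integral>\<^sup>+g. ennreal (hit A g * (1 - hit A g)) \<partial>conv_power m n) \<longlonglongrightarrow> 0"
proof -
  obtain T :: "'y topology" and b_act \<nu> where *: "topological_model act \<mu> T b_act \<nu>"
    "AE \<omega> in (\<Pi>\<^sub>M i\<in>(UNIV :: nat set). m).
           \<exists>y\<in>topspace T. weak_star_limit T (\<lambda>n. distr \<nu> \<nu> (b_act (walk \<omega> n))) (return \<nu> y)"
    using prox unfolding m_proximal_def by blast
  have "(\<lambda>n. ennreal (\<integral>g. hit A g * (1 - hit A g) \<partial>conv_power m n)) \<longlonglongrightarrow> ennreal 0"
    by (intro tendsto_ennrealI hit_variance_tendsto_0_of_model[OF * A])
  moreover have "ennreal (\<integral>g. hit A g * (1 - hit A g) \<partial>conv_power m n) =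
      (\<integral>\<^sup>+g. ennreal (hit A g * (1 - hit A g)) \<partial>conv_power m n)" for n
  proof -
    interpret P: prob_space "conv_power m n" by (rule prob_space_conv_power)
    have hp: "0 \<le> hit A g * (1 - hit A g)" "hit A g * (1 - hit A g) \<le> 1" for g
      using hit_bounds[of A g] by (auto intro!: mult_le_one)
    have "integrable (conv_power m n) (\<lambda>g. hit A g * (1 - hit A g))"
      by (rule P.integrable_const_bound[of _ 1]) (use hp in auto)
    then show ?thesis using hp by (intro nn_integral_eq_integral[symmetric]) auto
  qed
  ultimately show ?thesis by simp
qed

end

section \<open>Separable metric spaces\<close>

context Metric_space
begin

lemma separable_dense_sequence:
  assumes sep: "separable_space mtopology" and "M \<noteq> {}"
  shows "\<exists>z :: nat \<Rightarrow> 'a. (\<forall>i. z i \<in> M) \<and> (\<forall>x\<in>M. \<forall>e>0. \<exists>i. d (z i) x < e)"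
proof -
  obtain C where C: "countable C" "C \<subseteq> M" "mtopology closure_of C = M"
    using sep by (auto simp: separable_space_def)
  then have "C \<noteq> {}" using \<open>M \<noteq> {}\<close> by auto
  then have rg: "range (from_nat_into C) = C" using C(1) by (rule range_from_nat_into)
  have mem: "from_nat_into C i \<in> M" for i using rg C(2) by blast
  have "\<exists>i. d (from_nat_into C i) x < e" if x: "x \<in> M" and e: "e > 0" for x e
  proof -
    have "x \<in> mtopology closure_of C" using C(3) x by simp
    with e have "\<exists>y\<in>C. y \<in> mball x e" unfolding metric_closure_of by simp
    then obtain y where y: "y \<in> C" "y \<in> mball x e" ..
    from y(1) have "y \<in> range (from_nat_into C)" by (simp only: rg)
    then obtain i where i: "y = from_nat_into C i" by (rule rangeE)
    have "d y x < e" using y(2) by (simp add: commute)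
    then show ?thesis unfolding i by (rule exI)
  qed
  then show ?thesis using mem by (intro exI[of _ "from_nat_into C"]) simp
qed

lemma measurable_dist_const:
  assumes "z \<in> M" shows "(\<lambda>x. d z x) \<in> borel_measurable (borel_of mtopology)"
  unfolding borel_measurable_iff_less
proof
  fix a
  have "{w \<in> space (borel_of mtopology). d z w < a} = mball z a" using assms by auto
  then show "{w \<in> space (borel_of mtopology). d z w < a} \<in> sets (borel_of mtopology)"
    using borel_of_openin[OF openin_mball] by simp
qed

text \<open>Separability reduces \<open>d (u w) (v w) < a\<close> to a countable union of conditions
  on distances to fixed points \<open>z i\<close> of a dense sequence.\<close>

lemma measurable_dist:
  assumes sep: "separable_space mtopology" and "M \<noteq> {}"
    and u: "u \<in> measurable N (borel_of mtopology)" and v: "v \<in> measurable N (borel_of mtopology)"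
  shows "(\<lambda>w. d (u w) (v w)) \<in> borel_measurable N"
proof -
  from separable_dense_sequence[OF assms(1,2)] obtain z :: "nat \<Rightarrow> 'a" where
    "\<forall>i. z i \<in> M" "\<forall>x\<in>M. \<forall>e>0. \<exists>i. d (z i) x < e"
    by (elim exE conjE)
  note z = this[rule_format]
  have [measurable]: "(\<lambda>w. d (z i) (u w)) \<in> borel_measurable N" "(\<lambda>w. d (z i) (v w)) \<in> borel_measurable N" for i
    using measurable_compose[OF u measurable_dist_const[OF z(1)]]
      measurable_compose[OF v measurable_dist_const[OF z(1)]] by auto
  show ?thesis unfolding borel_measurable_iff_less
  proof
    fix a
    have "{w \<in> space N. d (u w) (v w) < a} = (\<Union>i. {w \<in> space N. d (z i) (u w) + d (z i) (v w) < a})"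
    proof (intro equalityI subsetI)
      fix w assume w: "w \<in> {w \<in> space N. d (u w) (v w) < a}"
      have M: "u w \<in> M" "v w \<in> M" using w measurable_space[OF u] measurable_space[OF v] by auto
      obtain i where i: "d (z i) (u w) < (a - d (u w) (v w)) / 2" using z(2)[OF M(1), of "(a - d (u w) (v w)) / 2"] w by auto
      have "d (z i) (v w) \<le> d (z i) (u w) + d (u w) (v w)" using z(1) M by (intro triangle) auto
      then have "d (z i) (u w) + d (z i) (v w) < a" using i by (simp add: field_simps)
      then show "w \<in> (\<Union>i. {w \<in> space N. d (z i) (u w) + d (z i) (v w) < a})" using w by auto
    next
      fix w assume "w \<in> (\<Union>i. {w \<in> space N. d (z i) (u w) + d (z i) (v w) < a})"
      then obtain i where i: "w \<in> space N" "d (z i) (u w) + d (z i) (v w) < a" by auto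
      have M: "u w \<in> M" "v w \<in> M" using i(1) measurable_space[OF u] measurable_space[OF v] by auto
      have "d (u w) (v w) \<le> d (u w) (z i) + d (z i) (v w)" using z(1) M by (intro triangle) auto
      then show "w \<in> {w \<in> space N. d (u w) (v w) < a}" using i by (simp add: commute)
    qed
    then show "{w \<in> space N. d (u w) (v w) < a} \<in> sets N" by simp
  qed
qed

text \<open>Balls of radius \<open>e / 2\<close> around a dense sequence, made disjoint.\<close>

lemma countable_small_partition:
  assumes sep: "separable_space mtopology" and "M \<noteq> {}" and "e > 0"
  shows "\<exists>B :: nat \<Rightarrow> 'a set. (\<forall>i. B i \<in> sets (borel_of mtopology)) \<and> disjoint_family B \<and>
    (\<Union>i. B i) = M \<and> (\<forall>i. \<forall>x\<in>B i. \<forall>y\<in>B i. d x y < e)"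
proof -
  from separable_dense_sequence[OF assms(1,2)] obtain z :: "nat \<Rightarrow> 'a" where
    "\<forall>i. z i \<in> M" "\<forall>x\<in>M. \<forall>e>0. \<exists>i. d (z i) x < e"
    by (elim exE conjE)
  note z = this[rule_format]
  define U where "U i = mball (z i) (e / 2)" for i
  have Us: "range U \<subseteq> sets (borel_of mtopology)"
    by (auto simp: U_def intro: borel_of_openin openin_mball)
  have "(\<Union>i. U i) = M"
  proof
    show "M \<subseteq> (\<Union>i. U i)"
    proof
      fix x assume x: "x \<in> M"
      obtain i where "d (z i) x < e / 2" using z(2)[OF x, of "e/2"] \<open>e > 0\<close> by auto
      then show "x \<in> (\<Union>i. U i)" using x z(1) by (auto simp: U_def)
    qed
  qed (auto simp: U_def)
  moreover have "d x y < e" if "x \<in> disjointed U i" "y \<in> disjointed U i" for i x y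
  proof -
    have xy: "x \<in> mball (z i) (e/2)" "y \<in> mball (z i) (e/2)"
      using that disjointed_subset[of U i] by (auto simp: U_def)
    then have "d x y \<le> d x (z i) + d (z i) y" using z(1) by (intro triangle) auto
    then show ?thesis using xy by (auto simp: commute)
  qed
  moreover have "disjointed U i \<in> sets (borel_of mtopology)" for i
    using sets.range_disjointed_sets[OF Us] by auto
  ultimately show ?thesis
    using disjoint_family_disjointed[of U] UN_disjointed_eq[of U] by (intro exI[of _ "disjointed U"]) simp
qed

end

section \<open>Equivariant maps from the square to isometric spaces\<close>

context nonsingular_action
begin

text \<open>Independence is stated through pairs \<open>q\<close> of second coordinates, so no
  constant has to be chosen for each \<open>x\<close>. Applied to the map with swapped arguments,
  the same lemma handles the first coordinate.\<close>

lemma equivariant_AE_independent_snd: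
  fixes Z :: "'z set"
  assumes prox: "m_proximal TYPE('y) m act \<mu>" and sym: "symmetric_measure m"
    and Z: "Metric_space Z d" and sep: "separable_space (Metric_space.mtopology Z d)"
    and iso: "\<And>g z w. z \<in> Z \<Longrightarrow> w \<in> Z \<Longrightarrow> d (z_act g z) (z_act g w) = d z w"
    and \<phi>[measurable]: "\<phi> \<in> measurable (\<mu> \<Otimes>\<^sub>M \<mu>) (borel_of (Metric_space.mtopology Z d))"
    and equi: "\<And>g. AE p in \<mu> \<Otimes>\<^sub>M \<mu>. \<phi> (diagonal_action act g p) = z_act g (\<phi> p)"
  shows "AE x in \<mu>. AE q in \<mu> \<Otimes>\<^sub>M \<mu>. \<phi> (x, fst q) = \<phi> (x, snd q)"
proof -
  interpret M: Metric_space Z d by (rule Z)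
  interpret PP: pair_prob_space \<mu> \<mu> ..
  have \<phi>Z: "\<phi> (x, y) \<in> Z" if "x \<in> space \<mu>" "y \<in> space \<mu>" for x y
    using measurable_space[OF \<phi>, of "(x, y)"] that by (simp add: space_pair_measure)
  have Z0: "Z \<noteq> {}" using \<phi>Z \<mu>.not_empty by blast
  define dd where "dd x y y' = d (\<phi> (x, y)) (\<phi> (x, y'))" for x y y'
  have dd_meas: "(\<lambda>w. dd (a w) (b w) (c w)) \<in> borel_measurable N"
    if [measurable]: "a \<in> measurable N \<mu>" "b \<in> measurable N \<mu>" "c \<in> measurable N \<mu>" for a b c N
    unfolding dd_def using sep Z0 by (intro M.measurable_dist) auto
  have small: "AE x in \<mu>. AE q in \<mu> \<Otimes>\<^sub>M \<mu>. dd x (fst q) (snd q) < r" if r: "0 < r" for r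
  proof -
    obtain B :: "nat \<Rightarrow> 'z set" where B[measurable]: "\<And>i. B i \<in> sets (borel_of M.mtopology)"
      and disj: "disjoint_family B" and UB: "(\<Union>i. B i) = Z"
      and dB: "\<And>i x y. x \<in> B i \<Longrightarrow> y \<in> B i \<Longrightarrow> d x y < r"
      using M.countable_small_partition[OF sep Z0 r] by blast
    define J :: "'x \<Rightarrow> 'x \<Rightarrow> 'x \<Rightarrow> ennreal" where "J x y y' = indicator {r..} (dd x y y')" for x y y'
    have J_meas[measurable]: "(\<lambda>w. J (a w) (b w) (c w)) \<in> borel_measurable N"
      if [measurable]: "a \<in> measurable N \<mu>" "b \<in> measurable N \<mu>" "c \<in> measurable N \<mu>" for a b c N
      using dd_meas[OF that] unfolding J_def by measurable
    \<comment> \<open>The probability that two independent second coordinates give values at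
      distance at least \<open>r\<close>; the goal is that it vanishes almost everywhere.\<close>
    define H where "H x = (\<integral>\<^sup>+y. \<integral>\<^sup>+y'. J x y y' \<partial>\<mu> \<partial>\<mu>)" for x
    have [measurable]: "H \<in> borel_measurable \<mu>" unfolding H_def by measurable
    define K where "K w g = (\<integral>\<^sup>+y. \<integral>\<^sup>+y'. J w (act g y) (act g y') \<partial>\<mu> \<partial>\<mu>)" for w g
    have K_meas[measurable]: "(\<lambda>p. K (fst p) (snd p)) \<in> borel_measurable (\<mu> \<Otimes>\<^sub>M borel)"
      unfolding K_def by measurable
    \<comment> \<open>Equivariance reads
      \<open>\<phi> (act g w, y) = z_act g (\<phi> (w, act (- g) y))\<close>; the outer
      \<open>z_act g\<close> cancels because it is an isometry. So moving \<open>w\<close> by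
      \<open>g\<close> amounts to moving both second coordinates by \<open>- g\<close>.\<close>
    have HK: "(\<integral>\<^sup>+w. H (act g w) \<partial>\<mu>) = (\<integral>\<^sup>+w. K w (- g) \<partial>\<mu>)" for g
    proof (rule nn_integral_cong_AE)
      have "AE w in \<mu>. AE u in \<mu>. \<phi> (act g w, act g u) = z_act g (\<phi> (w, u))"
        using PP.AE_pair[OF equi[of g]] by (simp add: diagonal_action_def)
      then show "AE w in \<mu>. H (act g w) = K w (- g)"
      proof (rule AE_mp, intro AE_I2 impI)
        fix w assume w: "w \<in> space \<mu>" and "AE u in \<mu>. \<phi> (act g w, act g u) = z_act g (\<phi> (w, u))"
        \<comment> \<open>Substituting \<open>u = act (- g) y\<close> in an almost sure statement
          relies on quasi-invariance.\<close>
        from AE_act[OF this(2), of "- g"]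
        have ae: "AE y in \<mu>. \<phi> (act g w, y) = z_act g (\<phi> (w, act (- g) y))"
          by (rule AE_mp) (intro AE_I2, simp)
        show "H (act g w) = K w (- g)" unfolding H_def K_def
        proof (rule nn_integral_cong_AE, use ae in \<open>rule AE_mp\<close>, intro AE_I2 impI)
          fix y assume y: "y \<in> space \<mu>" and ey: "\<phi> (act g w, y) = z_act g (\<phi> (w, act (- g) y))"
          show "(\<integral>\<^sup>+y'. J (act g w) y y' \<partial>\<mu>) = (\<integral>\<^sup>+y'. J w (act (- g) y) (act (- g) y') \<partial>\<mu>)"
          proof (rule nn_integral_cong_AE, use ae in \<open>rule AE_mp\<close>, intro AE_I2 impI)
            fix y' assume y': "y' \<in> space \<mu>" and ey': "\<phi> (act g w, y') = z_act g (\<phi> (w, act (- g) y'))"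
            have "dd (act g w) y y' = dd w (act (- g) y) (act (- g) y')"
              unfolding dd_def ey ey' using w y y' by (intro iso \<phi>Z) auto
            then show "J (act g w) y y' = J w (act (- g) y) (act (- g) y')" by (simp add: J_def)
          qed
        qed
      qed
    qed
    \<comment> \<open>Stationarity in the first coordinate, then \<open>HK\<close>; symmetry of
      \<open>m\<close> removes the minus sign.\<close>
    have IK: "(\<integral>\<^sup>+x. H x \<partial>\<mu>) = (\<integral>\<^sup>+w. \<integral>\<^sup>+g. K w g \<partial>conv_power m n \<partial>\<mu>)" for n
    proof -
      interpret P: prob_space "conv_power m n" by (rule prob_space_conv_power)
      interpret Q: pair_prob_space \<mu> "conv_power m n" ..
      have K': "(\<lambda>(x, y). K x y) \<in> borel_measurable (\<mu> \<Otimes>\<^sub>M conv_power m n)"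
        using K_meas by (simp add: split_beta' cong: measurable_cong_sets sets_pair_measure_cong)
      have "(\<integral>\<^sup>+x. H x \<partial>\<mu>) = (\<integral>\<^sup>+g. \<integral>\<^sup>+w. H (act g w) \<partial>\<mu> \<partial>conv_power m n)"
        by (rule nn_integral_stationary[symmetric]) measurable
      also have "\<dots> = (\<integral>\<^sup>+g. \<integral>\<^sup>+w. K w (- g) \<partial>\<mu> \<partial>conv_power m n)" by (simp only: HK)
      also have "\<dots> = (\<integral>\<^sup>+g. \<integral>\<^sup>+w. K w g \<partial>\<mu> \<partial>conv_power m n)"
      proof (rule nn_integral_conv_power_uminus[OF sym])
        show "(\<lambda>g. \<integral>\<^sup>+w. K w g \<partial>\<mu>) \<in> borel_measurable borel" unfolding K_def by measurable
      qed
      also have "\<dots> = (\<integral>\<^sup>+w. \<integral>\<^sup>+g. K w g \<partial>conv_power m n \<partial>\<mu>)"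
        using K' by (rule Q.Fubini')
      finally show ?thesis .
    qed
    define A where "A w i = {u\<in>space \<mu>. \<phi> (w, u) \<in> B i}" for w i
    have A[measurable]: "A w i \<in> sets \<mu>" if "w \<in> space \<mu>" for w i
    proof -
      have [measurable]: "(\<lambda>u. \<phi> (w, u)) \<in> measurable \<mu> (borel_of M.mtopology)"
        using measurable_Pair2[OF \<phi> that] .
      show ?thesis unfolding A_def by measurable
    qed
    define V where "V w i g = ennreal (hit (A w i) g * (1 - hit (A w i) g))" for w i g
    \<comment> \<open>Values at distance at least \<open>r\<close> lie in different pieces
      \<open>B i\<close>. As \<open>y\<close> and \<open>y'\<close> are independent, the event that
      only the first falls into piece \<open>i\<close> has probability \<open>hit\<close> times
      \<open>1 - hit\<close>.\<close>
    have KV: "K w g \<le> (\<Sum>i. V w i g)" if w: "w \<in> space \<mu>" for w g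
    proof -
      have [measurable]: "A w i \<in> sets \<mu>" for i using A[OF w] .
      have "K w g \<le> (\<integral>\<^sup>+y. \<integral>\<^sup>+y'. (\<Sum>i. indicator (A w i) (act g y) * indicator (space \<mu> - A w i) (act g y')) \<partial>\<mu> \<partial>\<mu>)"
        unfolding K_def
      proof (intro nn_integral_mono)
        fix y y' assume y: "y \<in> space \<mu>" and y': "y' \<in> space \<mu>"
        define u u' where "u = act g y" and "u' = act g y'"
        have u: "u \<in> space \<mu>" "u' \<in> space \<mu>" using y y' by (auto simp: u_def u'_def)
        have "\<phi> (w, u) \<in> (\<Union>i. B i)" unfolding UB using \<phi>Z w u by blast
        then obtain i where i: "\<phi> (w, u) \<in> B i" by blast
        have "J w u u' \<le> indicator (A w i) u * indicator (space \<mu> - A w i) u'"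
        proof (cases "\<phi> (w, u') \<in> B i")
          case True
          then have "dd w u u' < r" unfolding dd_def using dB i by blast
          then show ?thesis by (simp add: J_def)
        next
          case False
          then show ?thesis using i u by (simp add: J_def A_def indicator_def)
        qed
        also have "\<dots> \<le> (\<Sum>j. indicator (A w j) u * indicator (space \<mu> - A w j) u')"
          using sum_le_suminf[of "\<lambda>j. indicator (A w j) u * indicator (space \<mu> - A w j) u' :: ennreal" "{i}"]
          by (simp only: sum.insert sum.empty finite.intros empty_iff not_False_eq_True add_0_right) simp
        finally show "J w (act g y) (act g y') \<le> (\<Sum>i. indicator (A w i) (act g y) * indicator (space \<mu> - A w i) (act g y'))"
          by (simp add: u_def u'_def)
      qed
      also have "\<dots> = (\<Sum>i. \<integral>\<^sup>+y. \<integral>\<^sup>+y'. indicator (A w i) (act g y) * indicator (space \<mu> - A w i) (act g y') \<partial>\<mu> \<partial>\<mu>)"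
        by (simp add: nn_integral_suminf)
      also have "\<dots> = (\<Sum>i. V w i g)"
      proof (rule suminf_cong)
        fix i
        have "(\<integral>\<^sup>+y. \<integral>\<^sup>+y'. indicator (A w i) (act g y) * indicator (space \<mu> - A w i) (act g y') \<partial>\<mu> \<partial>\<mu>) =
            ennreal (hit (A w i) g) * ennreal (hit (space \<mu> - A w i) g)"
          by (simp add: nn_integral_cmult nn_integral_multc ennreal_hit_nn_integral)
        moreover have "hit (space \<mu> - A w i) g = 1 - hit (A w i) g"
        proof -
          have "{x\<in>space \<mu>. act g x \<in> space \<mu> - A w i} = space \<mu> - {x\<in>space \<mu>. act g x \<in> A w i}" by auto
          then show ?thesis unfolding hit_def by (simp add: \<mu>.prob_compl)
        qed
        ultimately show "(\<integral>\<^sup>+y. \<integral>\<^sup>+y'. indicator (A w i) (act g y) * indicator (space \<mu> - A w i) (act g y') \<partial>\<mu> \<partial>\<mu>) = V w i g"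
          by (simp add: V_def ennreal_mult)
      qed
      finally show ?thesis .
    qed
    have a_eq: "ennreal (hit (A w i) g) = (\<integral>\<^sup>+u. indicator (B i) (\<phi> (w, act g u)) \<partial>\<mu>)" if "w \<in> space \<mu>" for w i g
      unfolding ennreal_hit_nn_integral[OF A[OF that]]
      by (intro nn_integral_cong) (simp add: A_def indicator_def)
    define vv where "vv n w i = (\<integral>\<^sup>+g. V w i g \<partial>conv_power m n)" for n w i
    \<comment> \<open>A bound independent of \<open>n\<close> with sum 1 over \<open>i\<close>,
      which dominates the series so that the limit in \<open>n\<close> can be taken
      termwise.\<close>
    have vv_le: "vv n w i \<le> emeasure \<mu> (A w i)" if w: "w \<in> space \<mu>" for n w i
    proof -
      have "vv n w i \<le> (\<integral>\<^sup>+g. ennreal (hit (A w i) g) \<partial>conv_power m n)"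
        unfolding vv_def V_def
        by (intro nn_integral_mono ennreal_leI) (simp add: mult_left_le)
      then show ?thesis using A[OF w] by (simp add: nn_integral_hit)
    qed
    have sumA: "(\<Sum>i. emeasure \<mu> (A w i)) = 1" if w: "w \<in> space \<mu>" for w
    proof -
      have "(\<Sum>i. emeasure \<mu> (A w i)) = emeasure \<mu> (\<Union>i. A w i)"
        using A[OF w] disj by (intro suminf_emeasure) (auto simp: disjoint_family_on_def A_def)
      also have "(\<Union>i. A w i) = space \<mu>"
        using UB \<phi>Z[OF w] by (auto simp: A_def)
      finally show ?thesis by (simp add: \<mu>.emeasure_space_1)
    qed
    have lim_w: "(\<lambda>n. \<Sum>i. vv n w i) \<longlonglongrightarrow> 0" if w: "w \<in> space \<mu>" for w
    proof -
      have "(\<lambda>n. \<integral>\<^sup>+i. vv n w i \<partial>count_space UNIV) \<longlonglongrightarrow> (\<integral>\<^sup>+i. 0 \<partial>count_space (UNIV :: nat set))"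
      proof (rule nn_integral_dominated_convergence[where w="\<lambda>i. emeasure \<mu> (A w i)"])
        show "(\<integral>\<^sup>+i. emeasure \<mu> (A w i) \<partial>count_space UNIV) < \<infinity>"
          by (simp add: nn_integral_count_space_nat sumA[OF w])
        show "AE i in count_space UNIV. (\<lambda>n. vv n w i) \<longlonglongrightarrow> 0"
          unfolding vv_def V_def by (intro AE_I2 hit_variance_tendsto_0[OF prox] A w)
      qed (use vv_le[OF w] in auto)
      then show ?thesis by (simp add: nn_integral_count_space_nat)
    qed
    \<comment> \<open>\<open>A w i\<close> is a measurable set only for each fixed \<open>w\<close>.
      Writing \<open>hit (A w i) g\<close> as an integral jointly measurable in \<open>w\<close> and
      \<open>g\<close> gives measurability of the series in \<open>w\<close>.\<close>
    define b where "b i w g = (\<integral>\<^sup>+u. indicator (B i) (\<phi> (w, act g u)) \<partial>\<mu>)" for i w g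
    have V_b: "V w i g = b i w g * (1 - b i w g)" if w: "w \<in> space \<mu>" for w i g
      unfolding V_def b_def a_eq[OF w, symmetric]
      by (simp add: ennreal_mult ennreal_minus flip: ennreal_1)
    have [measurable]: "(\<lambda>w. \<Sum>i. vv n w i) \<in> borel_measurable \<mu>" for n
    proof -
      interpret P: prob_space "conv_power m n" by (rule prob_space_conv_power)
      have "(\<lambda>w. \<Sum>i. \<integral>\<^sup>+g. b i w g * (1 - b i w g) \<partial>conv_power m n) \<in> borel_measurable \<mu>"
        unfolding b_def by measurable
      moreover have "(\<Sum>i. \<integral>\<^sup>+g. b i w g * (1 - b i w g) \<partial>conv_power m n) = (\<Sum>i. vv n w i)" if "w \<in> space \<mu>" for w
        unfolding vv_def by (intro suminf_cong nn_integral_cong V_b[OF that, symmetric])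
      ultimately show ?thesis by (subst measurable_cong[symmetric]) auto
    qed
    have "(\<lambda>n. \<integral>\<^sup>+w. (\<Sum>i. vv n w i) \<partial>\<mu>) \<longlonglongrightarrow> (\<integral>\<^sup>+w. 0 \<partial>\<mu>)"
    proof (rule nn_integral_dominated_convergence[where w="\<lambda>_. 1"])
      show "AE w in \<mu>. (\<Sum>i. vv n w i) \<le> 1" for n
      proof (rule AE_I2)
        fix w assume w: "w \<in> space \<mu>"
        show "(\<Sum>i. vv n w i) \<le> 1" unfolding sumA[OF w, symmetric]
          using vv_le[OF w] by (intro suminf_le) auto
      qed
      show "AE w in \<mu>. (\<lambda>n. \<Sum>i. vv n w i) \<longlonglongrightarrow> 0" using lim_w by (intro AE_I2)
    qed (auto simp: \<mu>.emeasure_space_1)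
    moreover have "(\<integral>\<^sup>+x. H x \<partial>\<mu>) \<le> (\<integral>\<^sup>+w. (\<Sum>i. vv n w i) \<partial>\<mu>)" for n
      unfolding IK[of n]
    proof (rule nn_integral_mono)
      fix w assume w: "w \<in> space \<mu>"
      have [measurable]: "V w i \<in> borel_measurable borel" for i
        using A[OF w] unfolding V_def by measurable
      have "(\<integral>\<^sup>+g. K w g \<partial>conv_power m n) \<le> (\<integral>\<^sup>+g. (\<Sum>i. V w i g) \<partial>conv_power m n)"
        using KV[OF w] by (intro nn_integral_mono)
      also have "\<dots> = (\<Sum>i. vv n w i)"
        unfolding vv_def by (rule nn_integral_suminf) measurable
      finally show "(\<integral>\<^sup>+g. K w g \<partial>conv_power m n) \<le> (\<Sum>i. vv n w i)" .
    qed
    \<comment> \<open>The left side does not depend on \<open>n\<close> and is bounded by every term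
      of a null sequence.\<close>
    ultimately have "(\<integral>\<^sup>+x. H x \<partial>\<mu>) \<le> 0"
      by (intro LIMSEQ_le_const) auto
    then have "AE x in \<mu>. H x = 0" by (simp add: nn_integral_0_iff_AE)
    then show ?thesis using AE_space
    proof eventually_elim
      fix x assume Hx: "H x = 0" and x: "x \<in> space \<mu>"
      have m: "(\<lambda>q. J x (fst q) (snd q)) \<in> borel_measurable (\<mu> \<Otimes>\<^sub>M \<mu>)" using x by measurable
      have "(\<integral>\<^sup>+q. J x (fst q) (snd q) \<partial>(\<mu> \<Otimes>\<^sub>M \<mu>)) = H x"
        unfolding H_def using \<mu>.nn_integral_fst[OF m] by simp
      then have "AE q in \<mu> \<Otimes>\<^sub>M \<mu>. J x (fst q) (snd q) = 0"
        using Hx m by (simp add: nn_integral_0_iff_AE)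
      then show "AE q in \<mu> \<Otimes>\<^sub>M \<mu>. dd x (fst q) (snd q) < r"
        by (rule AE_mp) (intro AE_I2, auto simp: J_def indicator_def split: if_splits)
    qed
  qed
  have "AE x in \<mu>. \<forall>k::nat. AE q in \<mu> \<Otimes>\<^sub>M \<mu>. dd x (fst q) (snd q) < inverse (real (Suc k))"
    unfolding AE_all_countable by (intro allI small) simp
  then show ?thesis using AE_space
  proof eventually_elim
    fix x assume x: "x \<in> space \<mu>"
      and "\<forall>k::nat. AE q in \<mu> \<Otimes>\<^sub>M \<mu>. dd x (fst q) (snd q) < inverse (real (Suc k))"
    then have "AE q in \<mu> \<Otimes>\<^sub>M \<mu>. \<forall>k::nat. dd x (fst q) (snd q) < inverse (real (Suc k))"
      by (simp only: AE_all_countable simp_thms)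
    then show "AE q in \<mu> \<Otimes>\<^sub>M \<mu>. \<phi> (x, fst q) = \<phi> (x, snd q)"
    proof (rule AE_mp, intro AE_I2 impI)
      fix q assume q: "q \<in> space (\<mu> \<Otimes>\<^sub>M \<mu>)" and l: "\<forall>k::nat. dd x (fst q) (snd q) < inverse (real (Suc k))"
      have "dd x (fst q) (snd q) \<le> 0"
      proof (rule ccontr)
        assume "\<not> ?thesis"
        then obtain k where "inverse (real (Suc k)) < dd x (fst q) (snd q)"
          using reals_Archimedean[of "dd x (fst q) (snd q)"] by auto
        with l[rule_format, of k] show False by simp
      qed
      moreover have "\<phi> (x, fst q) \<in> Z" "\<phi> (x, snd q) \<in> Z"
        using q x by (auto intro!: \<phi>Z simp: space_pair_measure)
      ultimately show "\<phi> (x, fst q) = \<phi> (x, snd q)"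
        unfolding dd_def using M.zero M.nonneg by (metis antisym)
    qed
  qed
qed

end

section \<open>The square: nonsingularity, isometric coefficients, ergodicity\<close>

lemma (in prob_space) AE_obtain:
  assumes "AE x in M. P x" shows "\<exists>x\<in>space M. P x"
proof (rule ccontr)
  assume none: "\<not> ?thesis"
  from assms AE_space have "AE x in M. False"
    by eventually_elim (use none in blast)
  then show False by simp
qed

lemma Metric_space_discrete_bool: "Metric_space (UNIV :: bool set) (\<lambda>x y. if x = y then 0 else 1)"
  by unfold_locales (auto split: if_splits)

context nonsingular_action
begin

text \<open>By Fubini the two coordinates can be translated one after the other, each time by
  quasi-invariance of \<open>\<mu>\<close>.\<close>

lemma nonsingular_diagonal: "nonsingular_system (diagonal_action act) (\<mu> \<Otimes>\<^sub>M \<mu>)"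
proof -
  interpret PP: pair_prob_space \<mu> \<mu> ..
  interpret D: measurable_action "diagonal_action act" "\<mu> \<Otimes>\<^sub>M \<mu>"
    by unfold_locales (rule standard_borel_G_space_diagonal)
  show ?thesis
  proof (rule D.nonsingular_systemI)
    show "prob_space (\<mu> \<Otimes>\<^sub>M \<mu>)" by (rule PP.prob_space_axioms)
    fix A g assume A[measurable]: "A \<in> sets (\<mu> \<Otimes>\<^sub>M \<mu>)" and null: "emeasure (\<mu> \<Otimes>\<^sub>M \<mu>) A = 0"
    have "AE p in \<mu> \<Otimes>\<^sub>M \<mu>. p \<notin> A" using A null by (intro AE_not_in) (auto simp: null_sets_def)
    then have "AE x in \<mu>. AE y in \<mu>. (x, y) \<notin> A" by (rule PP.AE_pair)
    then have "AE x in \<mu>. AE y in \<mu>. (x, act g y) \<notin> A"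
    proof eventually_elim
      case (elim x)
      then show ?case by (rule AE_act)
    qed
    then have "AE x in \<mu>. AE y in \<mu>. (act g x, act g y) \<notin> A" by (rule AE_act)
    then have "AE p in \<mu> \<Otimes>\<^sub>M \<mu>. diagonal_action act g p \<notin> A"
      by (intro PP.AE_pair_measure) (auto simp: diagonal_action_def)
    then show "emeasure (\<mu> \<Otimes>\<^sub>M \<mu>) {p \<in> space (\<mu> \<Otimes>\<^sub>M \<mu>). diagonal_action act g p \<in> A} = 0"
      by (subst (asm) AE_iff_measurable[OF _ refl]) auto
  qed
qed

text \<open>A map that depends on neither coordinate is constant: its value at a suitable
  \<open>(x0, y0)\<close> is carried first along the first coordinate, then along the
  second.\<close>

lemma EIC_square:
  assumes prox: "m_proximal TYPE('y) m act \<mu>" and sym: "symmetric_measure m"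
  shows "EIC TYPE('z) (diagonal_action act) (\<mu> \<Otimes>\<^sub>M \<mu>)"
  unfolding EIC_def
proof (intro conjI allI impI, rule nonsingular_diagonal, elim conjE)
  fix Z :: "'z set" and d z_act \<phi>
  assume Z: "Metric_space Z d" and sep: "separable_space (Metric_space.mtopology Z d)"
    and iso: "\<forall>g. \<forall>z\<in>Z. \<forall>w\<in>Z. d (z_act g z) (z_act g w) = d z w"
    and \<phi>[measurable]: "\<phi> \<in> measurable (\<mu> \<Otimes>\<^sub>M \<mu>) (borel_of (Metric_space.mtopology Z d))"
    and equi: "\<forall>g. AE p in \<mu> \<Otimes>\<^sub>M \<mu>. \<phi> (diagonal_action act g p) = z_act g (\<phi> p)"
  interpret M: Metric_space Z d by (rule Z)
  interpret PP: pair_prob_space \<mu> \<mu> ..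
  interpret P3: pair_prob_space \<mu> "\<mu> \<Otimes>\<^sub>M \<mu>" ..
  have \<phi>Z: "\<phi> (x, y) \<in> Z" if "x \<in> space \<mu>" "y \<in> space \<mu>" for x y
    using measurable_space[OF \<phi>, of "(x, y)"] that by (simp add: space_pair_measure)
  have Z0: "Z \<noteq> {}" using \<phi>Z \<mu>.not_empty by blast
  have const_snd: "AE x in \<mu>. AE q in \<mu> \<Otimes>\<^sub>M \<mu>. \<phi> (x, fst q) = \<phi> (x, snd q)"
    using prox sym Z sep iso[rule_format] \<phi> equi[rule_format] by (rule equivariant_AE_independent_snd)
  define \<phi>' where "\<phi>' p = \<phi> (snd p, fst p)" for p
  have \<phi>'[measurable]: "\<phi>' \<in> measurable (\<mu> \<Otimes>\<^sub>M \<mu>) (borel_of M.mtopology)"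
    unfolding \<phi>'_def by measurable
  \<comment> \<open>Swapping coordinates preserves the product measure and commutes with the
    diagonal action.\<close>
  have equi': "AE p in \<mu> \<Otimes>\<^sub>M \<mu>. \<phi>' (diagonal_action act g p) = z_act g (\<phi>' p)" for g
  proof -
    have "AE p in distr (\<mu> \<Otimes>\<^sub>M \<mu>) (\<mu> \<Otimes>\<^sub>M \<mu>) (\<lambda>(x, y). (y, x)). \<phi> (diagonal_action act g p) = z_act g (\<phi> p)"
      using equi[rule_format, of g] by (simp only: PP.distr_pair_swap[symmetric])
    then have "AE p in \<mu> \<Otimes>\<^sub>M \<mu>. \<phi> (diagonal_action act g (case p of (x, y) \<Rightarrow> (y, x))) = z_act g (\<phi> (case p of (x, y) \<Rightarrow> (y, x)))"
      by (rule AE_distrD[rotated]) measurable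
    then show ?thesis by (simp add: \<phi>'_def diagonal_action_def split_beta')
  qed
  have "AE y in \<mu>. AE q in \<mu> \<Otimes>\<^sub>M \<mu>. \<phi>' (y, fst q) = \<phi>' (y, snd q)"
    using prox sym Z sep iso[rule_format] \<phi>' equi' by (rule equivariant_AE_independent_snd)
  \<comment> \<open>Equality of values is recast as distance zero, a measurable condition, because
    exchanging the order of the quantifiers below requires measurability.\<close>
  then have "AE y in \<mu>. AE q in \<mu> \<Otimes>\<^sub>M \<mu>. d (\<phi> (fst q, y)) (\<phi> (snd q, y)) = 0"
    using AE_space
  proof eventually_elim
    fix y assume y: "y \<in> space \<mu>" and "AE q in \<mu> \<Otimes>\<^sub>M \<mu>. \<phi>' (y, fst q) = \<phi>' (y, snd q)"
    from this(2) show "AE q in \<mu> \<Otimes>\<^sub>M \<mu>. d (\<phi> (fst q, y)) (\<phi> (snd q, y)) = 0"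
      using AE_space
    proof eventually_elim
      case (elim q)
      then show ?case using \<phi>Z y by (auto simp: \<phi>'_def space_pair_measure)
    qed
  qed
  moreover have [measurable]: "(\<lambda>p. d (\<phi> (fst (snd p), fst p)) (\<phi> (snd (snd p), fst p))) \<in> borel_measurable (\<mu> \<Otimes>\<^sub>M (\<mu> \<Otimes>\<^sub>M \<mu>))"
    using sep Z0 by (intro M.measurable_dist) measurable
  ultimately have "AE q in \<mu> \<Otimes>\<^sub>M \<mu>. AE y in \<mu>. d (\<phi> (fst q, y)) (\<phi> (snd q, y)) = 0"
    by (subst (asm) P3.AE_commute) auto
  then have "AE x in \<mu>. AE x' in \<mu>. AE y in \<mu>. d (\<phi> (x, y)) (\<phi> (x', y)) = 0"
    using PP.AE_pair by fastforce
  \<comment> \<open>Both independence statements must hold at one common point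
    \<open>x0\<close>.\<close>
  with const_snd have "AE x in \<mu>. (AE q in \<mu> \<Otimes>\<^sub>M \<mu>. \<phi> (x, fst q) = \<phi> (x, snd q)) \<and>
      (AE x' in \<mu>. AE y in \<mu>. d (\<phi> (x, y)) (\<phi> (x', y)) = 0)"
    by eventually_elim simp
  from \<mu>.AE_obtain[OF this] obtain x0 where x0: "x0 \<in> space \<mu>"
    and x0a: "AE q in \<mu> \<Otimes>\<^sub>M \<mu>. \<phi> (x0, fst q) = \<phi> (x0, snd q)"
    and x0b: "AE x' in \<mu>. AE y in \<mu>. d (\<phi> (x0, y)) (\<phi> (x', y)) = 0"
    by (elim bexE conjE)
  have "AE y in \<mu>. AE y' in \<mu>. \<phi> (x0, y) = \<phi> (x0, y')"
    using PP.AE_pair[OF x0a] by simp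
  from \<mu>.AE_obtain[OF this] obtain y0 where y0: "y0 \<in> space \<mu>"
    and y0a: "AE y' in \<mu>. \<phi> (x0, y0) = \<phi> (x0, y')"
    by (elim bexE)
  define c where "c = \<phi> (x0, y0)"
  have cZ: "c \<in> Z" unfolding c_def using x0 y0 by (rule \<phi>Z)
  have "AE x' in \<mu>. AE y in \<mu>. d c (\<phi> (x', y)) = 0"
    using x0b
  proof eventually_elim
    case (elim x')
    then show ?case using y0a by eventually_elim (simp add: c_def)
  qed
  moreover have [measurable]: "(\<lambda>p. d c (\<phi> p)) \<in> borel_measurable (\<mu> \<Otimes>\<^sub>M \<mu>)"
    using measurable_compose[OF \<phi> M.measurable_dist_const[OF cZ]] .
  ultimately have "AE p in \<mu> \<Otimes>\<^sub>M \<mu>. d c (\<phi> p) = 0"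
    by (intro PP.AE_pair_measure) auto
  then have "AE p in \<mu> \<Otimes>\<^sub>M \<mu>. \<phi> p = c" using AE_space
  proof eventually_elim
    case (elim p)
    then have "\<phi> p \<in> Z" using measurable_space[OF \<phi>, of p] by simp
    then show ?case using elim cZ M.zero[of c "\<phi> p"] by simp
  qed
  with cZ show "\<exists>z\<in>Z. AE p in \<mu> \<Otimes>\<^sub>M \<mu>. \<phi> p = z" ..
qed

end

text \<open>Membership in an almost invariant set is an equivariant map to the discrete two-point
  space with trivial action; its being constant says that the set is null or co-null.\<close>

lemma ergodic_system_of_EIC_bool:
  fixes act :: "'g::{topological_group_add, second_countable_topology} \<Rightarrow> 'x \<Rightarrow> 'x"
  assumes EIC: "EIC TYPE(bool) act \<mu>"
  shows "ergodic_system act \<mu>"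
proof -
  have ns: "nonsingular_system act \<mu>" using EIC by (simp add: EIC_def)
  then interpret measurable_action act \<mu> by unfold_locales (simp add: nonsingular_system_def)
  define d :: "bool \<Rightarrow> bool \<Rightarrow> real" where "d x y = (if x = y then 0 else 1)" for x y
  interpret M: Metric_space UNIV d using Metric_space_discrete_bool unfolding d_def .
  have sep: "separable_space M.mtopology"
    using closure_of_topspace[of M.mtopology]
    unfolding separable_space_def by (intro exI[of _ UNIV]) simp
  show ?thesis unfolding ergodic_system_def
  proof (intro conjI ballI impI ns)
    fix B assume B[measurable]: "B \<in> sets \<mu>" and inv: "\<forall>g. sym_diff (act g ` B) B \<in> null_sets \<mu>"
    have "(\<lambda>x. x \<in> B) \<in> measurable \<mu> (count_space UNIV)" by measurable
    moreover have "(\<lambda>x. x) \<in> measurable (count_space UNIV) (borel_of M.mtopology)" by simp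
    ultimately have "(\<lambda>x. x \<in> B) \<in> measurable \<mu> (borel_of M.mtopology)" by (rule measurable_compose)
    moreover have "AE x in \<mu>. (act g x \<in> B) = (x \<in> B)" for g
    proof -
      \<comment> \<open>Invariance of images at \<open>- g\<close> is invariance of preimages at
        \<open>g\<close>.\<close>
      have "act (- g) ` B = {x\<in>space \<mu>. act g x \<in> B}"
        using image_act[OF sets.sets_into_space[OF B], of "- g"] by simp
      then have "AE x in \<mu>. x \<notin> sym_diff {x\<in>space \<mu>. act g x \<in> B} B"
        using AE_not_in[OF inv[rule_format, of "- g"]] by simp
      then show ?thesis using AE_space by eventually_elim auto
    qed
    moreover have "action_on (\<lambda>g z. z) (UNIV :: bool set)" by (simp add: action_on_def)
    ultimately have "\<exists>z\<in>UNIV. AE x in \<mu>. (x \<in> B) = z"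
      using sep M.Metric_space_axioms
      by (intro EIC[unfolded EIC_def, THEN conjunct2, THEN spec[of _ UNIV], THEN spec[of _ d],
            THEN spec[of _ "\<lambda>g z. z"], THEN spec[of _ "\<lambda>x. x \<in> B"], THEN mp]) simp
    then obtain z where z: "AE x in \<mu>. (x \<in> B) = z" by blast
    show "emeasure \<mu> B = 0 \<or> emeasure \<mu> (space \<mu> - B) = 0"
    proof (cases z)
      case True
      from z have "AE x in \<mu>. \<not> (x \<in> space \<mu> - B)" by eventually_elim (simp add: True)
      then have "emeasure \<mu> (space \<mu> - B) = 0" by (subst (asm) AE_iff_measurable[of "space \<mu> - B"]) auto
      then show ?thesis ..
    next
      case False
      from z have "AE x in \<mu>. x \<notin> B" by eventually_elim (simp add: False)
      then have "emeasure \<mu> B = 0" using sets.sets_into_space[OF B] by (subst (asm) AE_iff_measurable[of B]) auto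
      then show ?thesis ..
    qed
  qed
qed

theorem theorem4p6:
  fixes m :: "'g::{topological_group_add, second_countable_topology, t2_space} measure"
    and act :: "'g \<Rightarrow> 'x \<Rightarrow> 'x"
    and \<mu> :: "'x measure"
  assumes "locally_compact_space (euclidean :: 'g topology)"
    and "prob_space m" and "sets m = sets borel"
    and "non_degenerate m" and "spread_out m" and "symmetric_measure m"
    and "standard_borel_G_space act \<mu>" and "prob_space \<mu>"
    and "stationary m act \<mu>"
    and "m_proximal TYPE('y) m act \<mu>"
  shows "doubly_ergodic act \<mu> \<and>
         EIC TYPE('z) (diagonal_action act) (\<mu> \<Otimes>\<^sub>M \<mu>)"
proof -
  interpret m: prob_space m by fact
  interpret \<mu>: prob_space \<mu> by fact
  interpret nonsingular_action m act \<mu> using assms by unfold_locales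
  show ?thesis
    \<comment> \<open>\<open>EIC_square\<close> is used twice: with the free type \<open>'z\<close>
      for the second claim and with \<open>bool\<close> for double ergodicity.\<close>
    using EIC_square[OF assms(10,6)] ergodic_system_of_EIC_bool[OF EIC_square[OF assms(10,6)]] nonsingular
    by (simp add: doubly_ergodic_def)
qed

end
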